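(* Let $\mathscr{A}\ne\varnothing$ be an abelian arrangement in $T\cong G^\ell$ and $H\in\mathscr{A}$. If $\mathscr{A}''$ is inductive with $\exp(\mathscr{A}'')=\{d_1,\dots,d_{\ell-1}\}$ and $\mathscr{A}'$ is inductive with $\exp(\mathscr{A}')=\{d_1,\dots,d_{\ell-1},d_\ell\}$, then $\mathscr{A}$ is inductive with $\exp(\mathscr{A})=\{d_1,\dots,d_{\ell-1},d_\ell+1\}$.
   Context: Setting: $G\cong(\mathbb{S}^1)^a\times\mathbb{R}^b$, $g=a+b$, $\Gamma\cong\mathbb{Z}^\ell$, $T=\operatorname{Hom}(\Gamma,G)$, $H_{\alpha,c}=\{\varphi\in T:\varphi(\alpha)=c\}$; an abelian arrangement is the set of connected components of $H_{\alpha,c}$ for $(\alpha,c)$ in a finite subset of $(\Gamma\setminus\{0\})\times G$; $\varnothing_\ell$ is the empty arrangement in $G^\ell$. $L(\mathscr{A})$: connected components of nonempty intersections of subsets of $\mathscr{A}$ (empty intersection $=T$), reverse inclusion, rank $\operatorname{codim}/g$; $\operatorname{rk}(\mathscr{A})$ is the maximal rank. $\chi_{\mathscr{A}}(t)=\sum_{X\in L(\mathscr{A})}\mu(T,X)t^{\dim_{\mathbb{R}}X}$. $\mathscr{A}$ is factorable if there are positive integers $d_1,\dots,d_{\operatorname{rk}(\mathscr{A})}$ with $\chi_{\mathscr{A}}(t)=t^{g(\ell-\operatorname{rk}\mathscr{A})}\prod_i(t^g-d_i)$; then $\exp(\mathscr{A}):=\{0^{\ell-\operatorname{rk}(\mathscr{A})}\}\cup\{d_1,\dots,d_{\operatorname{rk}(\mathscr{A})}\}$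 (a multiset of size $\ell$; $0^k$ means $0$ with multiplicity $k$). Inductive arrangements are factorable. For $H\in\mathscr{A}$: $\mathscr{A}'=\mathscr{A}\setminus\{H\}$ (in $T$) and $\mathscr{A}''=$ connected components of nonempty $K\cap H$, $K\in\mathscr{A}'$, an arrangement in $H\cong G^{\ell-1}$. Inductive arrangements: smallest class containing every $\varnothing_\ell$ ($\ell\ge1$) and containing $\mathscr{A}$ whenever some $H\in\mathscr{A}$ has $\mathscr{A}'',\mathscr{A}'$ inductive and $\chi_{\mathscr{A}'}(t)=(t^g-d)\chi_{\mathscr{A}''}(t)$ for some $d\in\mathbb{Z}$. *)

theory Defs
  imports "HOL-Analysis.Analysis" "HOL-Computational_Algebra.Polynomial" "HOL-Library.Multiset"
begin

text \<open>
Model.  The index type 'g has CARD('g) = g = a + b elements; the set C of indices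
(with card C = a) marks the circle coordinates, the remaining b coordinates are real.
G is realised as the subgroup of complex^'g whose C-coordinates are unit complex numbers
(group law: multiplication) and whose other coordinates are real (group law: addition).
Gamma = int^'l with CARD('l) = ell, and T = Hom(Gamma, G) = G^ell is realised as the set of
phi :: complex^'g^'l with every phi$i in G (phi$i = image of the i-th basis vector).
\<close>

definition Gset :: "'g set \<Rightarrow> (complex^'g) set" where
  "Gset C = {z. \<forall>j. (j \<in> C \<longrightarrow> cmod (z$j) = 1) \<and> (j \<notin> C \<longrightarrow> z$j \<in> \<real>)}"

definition Tor :: "'g set \<Rightarrow> (complex^'g^'l) set" where
  "Tor C = {phi. \<forall>i. phi$i \<in> Gset C}"

definition evalc :: "'g set \<Rightarrow> complex^'g^'l \<Rightarrow> int^'l \<Rightarrow> complex^'g" where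
  "evalc C phi alpha = (\<chi> j. if j \<in> C then (\<Prod>i\<in>UNIV. (phi$i$j) powi (alpha$i))
                                 else (\<Sum>i\<in>UNIV. of_int (alpha$i) * phi$i$j))"

definition Hyp :: "'g set \<Rightarrow> int^'l \<Rightarrow> complex^'g \<Rightarrow> (complex^'g^'l) set" where
  "Hyp C alpha c = {phi \<in> Tor C. evalc C phi alpha = c}"

text \<open>Layers: connected components of finite intersections of hypertori (T itself included).
These are the ambient spaces (each isomorphic to some G^k) in which arrangements live.\<close>
definition layer :: "'g set \<Rightarrow> (complex^'g^'l) set \<Rightarrow> bool" where
  "layer C S \<longleftrightarrow> (\<exists>F. finite F \<and> (\<forall>(alpha, c) \<in> F. c \<in> Gset C) \<and>
      S \<in> components (Tor C \<inter> \<Inter>((\<lambda>(alpha, c). Hyp C alpha c) ` F)))"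

text \<open>Abelian arrangement in the ambient layer S: a finite set of connected components of
hypertori S \<inter> H_{alpha,c} with alpha non-constant on S (for S = T this is alpha \<noteq> 0).\<close>
definition arr :: "'g set \<Rightarrow> (complex^'g^'l) set \<Rightarrow> (complex^'g^'l) set set \<Rightarrow> bool" where
  "arr C S A \<longleftrightarrow> layer C S \<and> finite A \<and>
     (\<forall>X \<in> A. \<exists>alpha c. c \<in> Gset C \<and>
        (\<exists>x\<in>S. \<exists>y\<in>S. evalc C x alpha \<noteq> evalc C y alpha) \<and>
        X \<in> components (S \<inter> Hyp C alpha c))"

text \<open>Exponential (universal covering) map R^{g ell} \<rightarrow> T and the real dimension of a layer,
computed as the affine dimension of a connected component of its lift.\<close>
definition Ecov :: "'g set \<Rightarrow> real^'g^'l \<Rightarrow> complex^'g^'l" where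
  "Ecov C x = (\<chi> i j. if j \<in> C then cis (2 * pi * x$i$j) else complex_of_real (x$i$j))"

definition dimR :: "'g set \<Rightarrow> (complex^'g^'l) set \<Rightarrow> int" where
  "dimR C X = aff_dim (connected_component_set (Ecov C -` X) (SOME x. Ecov C x \<in> X))"

definition restr :: "(complex^'g^'l) set \<Rightarrow> (complex^'g^'l) set set \<Rightarrow> (complex^'g^'l) set set" where
  "restr H A' = (\<Union>K \<in> A'. components (K \<inter> H))"

definition Lpos :: "(complex^'g^'l) set \<Rightarrow> (complex^'g^'l) set set \<Rightarrow> (complex^'g^'l) set set" where
  "Lpos S A = (\<Union>B \<in> Pow A. components (S \<inter> \<Inter>B))"

definition mobius :: "'a set \<Rightarrow> ('a \<Rightarrow> 'a \<Rightarrow> bool) \<Rightarrow> 'a \<Rightarrow> 'a \<Rightarrow> int" where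
  "mobius P le x = (THE f. \<forall>z. f z =
      (if x \<in> P \<and> z \<in> P \<and> le x z then
         (if z = x then 1 else - (\<Sum>w \<in> {w \<in> P. le x w \<and> le w z \<and> w \<noteq> z}. f w))
       else 0))"

definition charpoly :: "'g set \<Rightarrow> (complex^'g^'l) set \<Rightarrow> (complex^'g^'l) set set \<Rightarrow> int poly" where
  "charpoly C S A = (\<Sum>X \<in> Lpos S A.
      smult (mobius (Lpos S A) (\<lambda>X Y. Y \<subseteq> X) S X) (monom 1 (nat (dimR C X))))"

definition rkL :: "'g set \<Rightarrow> (complex^'g^'l) set \<Rightarrow> (complex^'g^'l) set \<Rightarrow> nat" where
  "rkL C S X = nat ((dimR C S - dimR C X) div int CARD('g))"

definition rkA :: "'g set \<Rightarrow> (complex^'g^'l) set \<Rightarrow> (complex^'g^'l) set set \<Rightarrow> nat" where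
  "rkA C S A = Max (rkL C S ` Lpos S A)"

definition ellA :: "'g set \<Rightarrow> (complex^'g^'l) set \<Rightarrow> nat" where
  "ellA C S = nat (dimR C S div int CARD('g))"

definition factor_exp :: "'g set \<Rightarrow> (complex^'g^'l) set \<Rightarrow> (complex^'g^'l) set set \<Rightarrow> int multiset \<Rightarrow> bool" where
  "factor_exp C S A M \<longleftrightarrow> (\<exists>ds :: int list. length ds = rkA C S A \<and> (\<forall>d \<in> set ds. d > 0) \<and>
      charpoly C S A = monom 1 (CARD('g) * (ellA C S - rkA C S A)) *
                       (\<Prod>d \<leftarrow> ds. monom 1 CARD('g) - [:d:]) \<and>
      M = replicate_mset (ellA C S - rkA C S A) 0 + mset ds)"

definition factorable :: "'g set \<Rightarrow> (complex^'g^'l) set \<Rightarrow> (complex^'g^'l) set set \<Rightarrow> bool" where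
  "factorable C S A \<longleftrightarrow> (\<exists>M. factor_exp C S A M)"

definition expA :: "'g set \<Rightarrow> (complex^'g^'l) set \<Rightarrow> (complex^'g^'l) set set \<Rightarrow> int multiset" where
  "expA C S A = (THE M. factor_exp C S A M)"

inductive inductive_arr :: "'g set \<Rightarrow> (complex^'g^'l) set \<Rightarrow> (complex^'g^'l) set set \<Rightarrow> bool"
  for C :: "'g set" where
  empty: "layer C S \<Longrightarrow> dimR C S \<ge> int CARD('g) \<Longrightarrow> inductive_arr C S {}"
| step: "arr C S A \<Longrightarrow> H \<in> A \<Longrightarrow> inductive_arr C S (A - {H}) \<Longrightarrow>
         inductive_arr C H (restr H (A - {H})) \<Longrightarrow>
         charpoly C S (A - {H}) = (monom 1 CARD('g) - [:d:]) * charpoly C H (restr H (A - {H})) \<Longrightarrow>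
         inductive_arr C S A"

end

theory Submission
  imports Defs
begin

text \<open>
By a cross-cut argument, \<open>\<mu>(S, X)\<close> is the sum of \<open>(-1)\<^bsup>|B|\<^esup>\<close> over the \<open>B \<subseteq> A\<close> for which \<open>X\<close> is a
component of \<open>S \<inter> \<Inter>B\<close>. Hence the characteristic polynomial is a signed sum over subsets of \<open>A\<close>, and
splitting that sum according to whether \<open>H \<in> B\<close> gives \<open>\<chi>\<^sub>A = \<chi>\<^sub>A\<^sub>' - \<chi>\<^sub>A\<^sub>'\<^sub>'\<close>. If the factors of \<open>\<chi>\<^sub>A\<^sub>'\<close> are those
of \<open>\<chi>\<^sub>A\<^sub>'\<^sub>'\<close> and \<open>t\<^sup>g - d\<close>, this replaces \<open>d\<close> by \<open>d + 1\<close>; the rank is tracked through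
\<open>rk A = max (rk A') (rk A'' + 1)\<close>. Finiteness and the dimensions come from lifting to the universal cover,
where every layer is the image of an affine subspace with direction \<open>W\<^sup>g\<close>, \<open>W \<subseteq> \<real>\<^sup>\<ell>\<close>.
\<close>

section \<open>The Moebius function of the poset of layers\<close>

text \<open>\<open>mobius\<close> is a definite description, so its values can be read off only once
  the recursion is known to have exactly one solution. The interval sums in the hypothesis are that
  recursion with the term at \<open>X\<close> moved to the other side.\<close>

lemma mobius_superset_eqI:
  fixes f :: "'a set \<Rightarrow> int"
  assumes fin: "finite P" and S: "S \<in> P"
    and f: "\<And>X. X \<in> P \<Longrightarrow> X \<subseteq> S \<Longrightarrow> (\<Sum>Y | Y \<in> P \<and> Y \<subseteq> S \<and> X \<subseteq> Y. f Y) = (if X = S then 1 else 0)"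
    and X: "X \<in> P" "X \<subseteq> S"
  shows "mobius P (\<lambda>X Y. Y \<subseteq> X) S X = f X"
proof -
  let ?rec = "\<lambda>h. \<forall>Z. h Z = (if S \<in> P \<and> Z \<in> P \<and> Z \<subseteq> S then
         (if Z = S then 1 else - (\<Sum>W \<in> {W \<in> P. W \<subseteq> S \<and> Z \<subseteq> W \<and> W \<noteq> Z}. h W)) else 0)"
  define h where "h Z = (if Z \<in> P \<and> Z \<subseteq> S then f Z else 0)" for Z
  have split: "(\<Sum>Y | Y \<in> P \<and> Y \<subseteq> S \<and> Z \<subseteq> Y. f Y)
      = f Z + (\<Sum>W \<in> {W \<in> P. W \<subseteq> S \<and> Z \<subseteq> W \<and> W \<noteq> Z}. f W)"
    if "Z \<in> P" "Z \<subseteq> S" for Z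
  proof -
    have "{Y. Y \<in> P \<and> Y \<subseteq> S \<and> Z \<subseteq> Y} = insert Z {W \<in> P. W \<subseteq> S \<and> Z \<subseteq> W \<and> W \<noteq> Z}"
      using that by auto
    then show ?thesis using fin by simp
  qed
  have hrec: "?rec h"
  proof
    fix Z
    have "f Z = (if Z = S then 1 else - (\<Sum>W \<in> {W \<in> P. W \<subseteq> S \<and> Z \<subseteq> W \<and> W \<noteq> Z}. f W))"
      if "Z \<in> P" "Z \<subseteq> S"
    proof (cases "Z = S")
      case True
      have "{W \<in> P. W \<subseteq> S \<and> S \<subseteq> W \<and> W \<noteq> S} = {}" by auto
      with split[OF that] f[OF that] True show ?thesis by (simp del: Collect_empty_eq)
    next
      case False
      with split[OF that] f[OF that] show ?thesis by simp
    qed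
    moreover have "(\<Sum>W \<in> {W \<in> P. W \<subseteq> S \<and> Z \<subseteq> W \<and> W \<noteq> Z}. f W)
        = (\<Sum>W \<in> {W \<in> P. W \<subseteq> S \<and> Z \<subseteq> W \<and> W \<noteq> Z}. h W)"
      by (rule sum.cong) (auto simp: h_def)
    ultimately show "h Z = (if S \<in> P \<and> Z \<in> P \<and> Z \<subseteq> S then
         (if Z = S then 1 else - (\<Sum>W \<in> {W \<in> P. W \<subseteq> S \<and> Z \<subseteq> W \<and> W \<noteq> Z}. h W)) else 0)"
      using S by (simp add: h_def[of Z])
  qed
  have uniq: "k = h" if krec: "?rec k" for k
  proof
    fix Z
    show "k Z = h Z"
    \<comment> \<open>The value at \<open>Z\<close> refers only to strict supersets of
      \<open>Z\<close> in \<open>P\<close>, which have fewer supersets themselves.\<close>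
    proof (induction "card {W \<in> P. Z \<subseteq> W}" arbitrary: Z rule: less_induct)
      case less
      have "k W = h W" if "W \<in> P" "Z \<subseteq> W" "W \<noteq> Z" "Z \<in> P" for W
      proof (rule less)
        have "{V \<in> P. W \<subseteq> V} \<subset> {V \<in> P. Z \<subseteq> V}" using that by blast
        then show "card {V \<in> P. W \<subseteq> V} < card {V \<in> P. Z \<subseteq> V}"
          using fin by (intro psubset_card_mono) auto
      qed
      then have "Z \<in> P \<Longrightarrow> (\<Sum>W \<in> {W \<in> P. W \<subseteq> S \<and> Z \<subseteq> W \<and> W \<noteq> Z}. k W)
          = (\<Sum>W \<in> {W \<in> P. W \<subseteq> S \<and> Z \<subseteq> W \<and> W \<noteq> Z}. h W)"
        by (intro sum.cong) auto
      with krec[rule_format, of Z] hrec[rule_format, of Z] show ?case by simp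
    qed
  qed
  have "mobius P (\<lambda>X Y. Y \<subseteq> X) S = h"
    unfolding mobius_def using hrec uniq by (rule the_equality)
  then show ?thesis using X by (simp add: h_def)
qed

lemma sum_Pow_neg_one_power_card:
  assumes "finite A"
  shows "(\<Sum>B\<in>Pow A. (-1) ^ card B) = (if A = {} then 1 else (0::int))"
proof (cases "A = {}")
  case False
  have "(\<Sum>B\<in>Pow A. (-1) ^ card B) = (\<Prod>x\<in>A. (1::int) - 1)"
    by (subst prod_diff_conv_sum) (simp_all add: assms)
  then show ?thesis using assms False by (simp add: card_gt_0_iff)
qed simp

text \<open>Summed over the layers between \<open>X\<close> and \<open>S\<close>, a set
  \<open>B\<close> counts once if all its members contain \<open>X\<close>, through the one
  component around \<open>X\<close>, and otherwise not at all. What remains is an alternating sum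
  over the subsets of \<open>{K \<in> A. X \<subseteq> K}\<close>.\<close>

lemma mobius_Lpos:
  assumes S: "connected S" "S \<noteq> {}" and fin: "finite A" "finite (Lpos S A)"
    and proper: "\<And>K. K \<in> A \<Longrightarrow> \<not> S \<subseteq> K" and X: "X \<in> Lpos S A"
  shows "mobius (Lpos S A) (\<lambda>X Y. Y \<subseteq> X) S X
       = (\<Sum>B | B \<in> Pow A \<and> X \<in> components (S \<inter> \<Inter>B). (-1) ^ card B)"
proof (rule mobius_superset_eqI)
  have sub: "X \<subseteq> S" "X \<noteq> {}" "connected X" if "X \<in> Lpos S A" for X
    using that in_components_subset in_components_nonempty in_components_connected
    by (fastforce simp: Lpos_def)+
  show "X \<subseteq> S" using sub X by auto
  have "components S = {S}" using S by (simp add: components_eq_sing_iff)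
  then show "S \<in> Lpos S A" unfolding Lpos_def by (auto intro!: bexI[of _ "{}"])
  fix X assume X: "X \<in> Lpos S A"
  let ?AX = "{K \<in> A. X \<subseteq> K}"
  let ?s = "\<lambda>B. (-1::int) ^ card B"
  have "(\<Sum>Y | Y \<in> Lpos S A \<and> Y \<subseteq> S \<and> X \<subseteq> Y. \<Sum>B | B \<in> Pow A \<and> Y \<in> components (S \<inter> \<Inter>B). ?s B)
      = (\<Sum>B\<in>Pow A. \<Sum>Y | Y \<in> {Y. Y \<in> Lpos S A \<and> Y \<subseteq> S \<and> X \<subseteq> Y} \<and> Y \<in> components (S \<inter> \<Inter>B). ?s B)"
    using sum.swap_restrict[of "{Y. Y \<in> Lpos S A \<and> Y \<subseteq> S \<and> X \<subseteq> Y}" "Pow A" "\<lambda>Y B. ?s B"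
        "\<lambda>Y B. Y \<in> components (S \<inter> \<Inter>B)"] fin by simp
  also have "\<dots> = (\<Sum>B\<in>Pow A. if B \<subseteq> ?AX then ?s B else 0)"
  proof (rule sum.cong[OF refl])
    fix B assume B: "B \<in> Pow A"
    let ?Q = "{Y. Y \<in> {Y. Y \<in> Lpos S A \<and> Y \<subseteq> S \<and> X \<subseteq> Y} \<and> Y \<in> components (S \<inter> \<Inter>B)}"
    show "(\<Sum>Y\<in>?Q. ?s B) = (if B \<subseteq> ?AX then ?s B else 0)"
    proof (cases "B \<subseteq> ?AX")
      case True
      then have XB: "X \<subseteq> S \<inter> \<Inter>B" using sub[OF X] by auto
      then obtain Y where Y: "Y \<in> components (S \<inter> \<Inter>B)" "X \<subseteq> Y"
        using exists_component_superset[OF XB] sub[OF X] by blast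
      have uniq: "Y' = Y" if "Y' \<in> components (S \<inter> \<Inter>B)" "X \<subseteq> Y'" for Y'
        using components_eq[OF that(1) Y(1)] that Y(2) sub(2)[OF X] by blast
      have YL: "Y \<in> Lpos S A" "Y \<subseteq> S"
        using Y(1) B in_components_subset[OF Y(1)] unfolding Lpos_def by blast+
      have "?Q = {Y}"
      proof (intro equalityI subsetI)
        show "Z \<in> {Y}" if "Z \<in> ?Q" for Z using uniq[of Z] that by blast
        show "Z \<in> ?Q" if "Z \<in> {Y}" for Z using that Y YL by blast
      qed
      then show ?thesis using True by simp
    next
      case False
      then obtain K where "K \<in> B" "\<not> X \<subseteq> K" using B by auto
      then have "?Q = {}" using in_components_subset[of _ "S \<inter> \<Inter>B"] by blast
      then show ?thesis using False by (simp only: sum.empty if_False)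
    qed
  qed
  also have "\<dots> = (\<Sum>B\<in>Pow ?AX. ?s B)"
    by (rule sum.mono_neutral_cong_right) (use fin in auto)
  also have "\<dots> = (if ?AX = {} then 1 else 0)"
    using fin by (intro sum_Pow_neg_one_power_card) auto
  \<comment> \<open>One direction is \<open>proper\<close>; for the other, \<open>X\<close> is a
    component of some \<open>S \<inter> \<Inter>B\<close> and every member of \<open>B\<close>
    contains \<open>X\<close>, so \<open>B\<close> is empty.\<close>
  also have "?AX = {} \<longleftrightarrow> X = S"
  proof
    assume e: "?AX = {}"
    obtain B where B: "B \<subseteq> A" "X \<in> components (S \<inter> \<Inter>B)" using X by (auto simp: Lpos_def)
    then have "B = {}" using e in_components_subset[OF B(2)] by blast
    then show "X = S" using B \<open>components S = {S}\<close> by simp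
  qed (use proper in auto)
  finally show "(\<Sum>Y | Y \<in> Lpos S A \<and> Y \<subseteq> S \<and> X \<subseteq> Y. \<Sum>B | B \<in> Pow A \<and> Y \<in> components (S \<inter> \<Inter>B). ?s B)
      = (if X = S then 1 else 0)" .
qed (use fin X in auto)

text \<open>Whitney's formula for arrangements whose intersections may be disconnected or empty:
  insert the cross-cut values and exchange the sums.\<close>

lemma charpoly_Whitney:
  fixes C :: "'g::finite set" and A :: "(complex^'g^'l) set set"
  assumes S: "connected S" "S \<noteq> {}" and fin: "finite A" "finite (Lpos S A)"
    and proper: "\<And>K. K \<in> A \<Longrightarrow> \<not> S \<subseteq> K"
  shows "charpoly C S A = (\<Sum>B\<in>Pow A. (-1) ^ card B *
           (\<Sum>X\<in>components (S \<inter> \<Inter>B). monom 1 (nat (dimR C X))))"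
proof -
  let ?m = "\<lambda>X. monom (1::int) (nat (dimR C X))"
  have "charpoly C S A = (\<Sum>X\<in>Lpos S A. \<Sum>B | B \<in> Pow A \<and> X \<in> components (S \<inter> \<Inter>B). (-1) ^ card B * ?m X)"
    unfolding charpoly_def
  proof (rule sum.cong[OF refl])
    fix X assume "X \<in> Lpos S A"
    have "smult ((-1) ^ n) p = (-1) ^ n * p" for n and p :: "int poly"
      by (induction n) auto
    then show "smult (mobius (Lpos S A) (\<lambda>X Y. Y \<subseteq> X) S X) (?m X)
        = (\<Sum>B | B \<in> Pow A \<and> X \<in> components (S \<inter> \<Inter>B). (-1) ^ card B * ?m X)"
      using mobius_Lpos[OF assms \<open>X \<in> Lpos S A\<close>] by (simp add: smult_sum)
  qed
  also have "\<dots> = (\<Sum>B\<in>Pow A. \<Sum>X | X \<in> Lpos S A \<and> X \<in> components (S \<inter> \<Inter>B). (-1) ^ card B * ?m X)"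
    using fin by (intro sum.swap_restrict) auto
  also have "\<dots> = (\<Sum>B\<in>Pow A. \<Sum>X\<in>components (S \<inter> \<Inter>B). (-1) ^ card B * ?m X)"
    by (intro sum.cong refl) (auto simp: Lpos_def)
  finally show ?thesis by (simp add: sum_distrib_left)
qed

section \<open>Layers after adding a hypertorus or restricting to one\<close>

lemma Lpos_insert:
  assumes "H \<subseteq> S"
  shows "Lpos S (insert H A) = Lpos S A \<union> Lpos H A"
proof -
  have "S \<inter> \<Inter>(insert H B) = H \<inter> \<Inter>B" for B using assms by auto
  then show ?thesis unfolding Lpos_def Pow_insert by (simp add: UN_Un)
qed

text \<open>Replacing \<open>K\<close> by a component of \<open>K \<inter> H\<close> does not change
  the layers, because a nonempty connected subset of \<open>K \<inter> H\<close> lies in exactly one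
  component. Polynomial and rank of a restriction can thus be computed with \<open>A\<close>
  itself.\<close>

lemma Lpos_restr: "Lpos H (restr H A) = Lpos H A"
proof (intro equalityI subsetI)
  fix X assume "X \<in> Lpos H (restr H A)"
  then obtain B where B: "B \<subseteq> restr H A" and X: "X \<in> components (H \<inter> \<Inter>B)"
    by (auto simp: Lpos_def)
  have "\<forall>L\<in>B. \<exists>K\<in>A. L \<in> components (K \<inter> H)" using B by (auto simp: restr_def)
  then obtain k where k: "\<And>L. L \<in> B \<Longrightarrow> k L \<in> A \<and> L \<in> components (k L \<inter> H)" by metis
  have Xs: "X \<noteq> {}" "X \<subseteq> H \<inter> \<Inter>B" "connected X"
    using X in_components_nonempty in_components_subset in_components_connected by blast+
  have "L \<subseteq> k L" if "L \<in> B" for L using in_components_subset[of L] k[OF that] by blast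
  then have "X \<subseteq> H \<inter> \<Inter>(k ` B)" using Xs(2) by blast
  then obtain Y where Y: "Y \<in> components (H \<inter> \<Inter>(k ` B))" "X \<subseteq> Y"
    using exists_component_superset Xs by (metis subset_empty)
  have Ys: "Y \<subseteq> H \<inter> \<Inter>(k ` B)" "connected Y"
    using in_components_subset[OF Y(1)] in_components_connected[OF Y(1)] by blast+
  \<comment> \<open>\<open>Y\<close> is connected, lies in \<open>k L \<inter> H\<close> and meets
    \<open>L\<close> along \<open>X\<close>, so it cannot leave the component
    \<open>L\<close>.\<close>
  have "Y \<subseteq> L" if L: "L \<in> B" for L
  proof (rule components_maximal)
    show "L \<in> components (k L \<inter> H)" using k L by blast
    show "Y \<subseteq> k L \<inter> H" using Ys(1) L by blast
    show "L \<inter> Y \<noteq> {}" using Xs(1,2) Y(2) L by blast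
  qed (rule Ys)
  then have "Y \<subseteq> H \<inter> \<Inter>B" using Ys(1) by blast
  then have "Y \<subseteq> X"
    by (rule components_maximal[OF X Ys(2)]) (use Xs(1) Y(2) in blast)
  then have "X = Y" using Y(2) by blast
  moreover have "k ` B \<subseteq> A" using k by blast
  ultimately show "X \<in> Lpos H A" using Y(1) unfolding Lpos_def by blast
next
  fix X assume "X \<in> Lpos H A"
  then obtain B where B: "B \<subseteq> A" and X: "X \<in> components (H \<inter> \<Inter>B)"
    by (auto simp: Lpos_def)
  have Xs: "X \<noteq> {}" "X \<subseteq> H \<inter> \<Inter>B" "connected X"
    using X in_components_nonempty in_components_subset in_components_connected by blast+
  have "\<forall>K\<in>B. \<exists>L\<in>components (K \<inter> H). X \<subseteq> L"
  proof
    fix K assume "K \<in> B"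
    then have "X \<subseteq> K \<inter> H" using Xs(2) by blast
    then show "\<exists>L\<in>components (K \<inter> H). X \<subseteq> L"
      using exists_component_superset[of X "K \<inter> H"] Xs(1,3) by blast
  qed
  then obtain l where l: "\<And>K. K \<in> B \<Longrightarrow> l K \<in> components (K \<inter> H) \<and> X \<subseteq> l K" by metis
  have "l K \<subseteq> K" if "K \<in> B" for K using in_components_subset[of "l K"] l[OF that] by blast
  then have "X \<subseteq> H \<inter> \<Inter>(l ` B)" "H \<inter> \<Inter>(l ` B) \<subseteq> H \<inter> \<Inter>B"
    using Xs(2) l by blast+
  \<comment> \<open>A component of the larger set that lies in the smaller one is maximal there as
    well.\<close>
  then have "X \<in> components (H \<inter> \<Inter>(l ` B))"
    using X unfolding in_components_maximal by (meson order_trans)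
  moreover have "l ` B \<subseteq> restr H A" using l B unfolding restr_def by blast
  ultimately show "X \<in> Lpos H (restr H A)" unfolding Lpos_def by blast
qed

section \<open>Exponents\<close>

text \<open>Each member of one multiset is a root of the other product, hence a member of the other
  multiset; the common factor is cancelled.\<close>

lemma prod_mset_linear_factors_inject:
  fixes M N :: "'a::idom multiset"
  assumes "(\<Prod>d\<in>#M. [:- d, 1:]) = (\<Prod>d\<in>#N. [:- d, 1:])"
  shows "M = N"
  using assms
proof (induction M arbitrary: N)
  case empty
  have "N = {#}"
  proof (rule ccontr)
    assume "N \<noteq> {#}"
    then obtain d where "d \<in># N" by blast
    then have "poly (\<Prod>d\<in>#N. [:- d, 1:]) d = 0"
      by (metis (no_types, lifting) dvd_prod_mset image_eqI poly_eq_0_iff_dvd set_image_mset)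
    then show False by (simp flip: empty)
  qed
  then show ?case by simp
next
  case (add d M)
  have "poly (\<Prod>d\<in>#N. [:- d, 1:]) d = 0" unfolding add.prems[symmetric] by simp
  then have "d \<in># N"
    by (auto simp: poly_prod_mset prod_mset_zero_iff image_iff)
  then obtain N' where N: "N = add_mset d N'" by (meson multi_member_split)
  have "[:- d, 1:] * (\<Prod>d\<in>#M. [:- d, 1:]) = [:- d, 1:] * (\<Prod>d\<in>#N'. [:- d, 1:])"
    using add.prems N by simp
  then have "M = N'" by (intro add.IH) (simp only: mult_cancel_left pCons_eq_0_iff, simp)
  then show ?case using N by simp
qed

text \<open>These products arise from linear factors by substituting t^g for t, which is injective
  for positive \<open>g\<close>.\<close>

lemma prod_mset_monom_factors_inject:
  fixes M N :: "int multiset"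
  assumes "g > 0" and eq: "(\<Prod>d\<in>#M. monom 1 g - [:d:]) = (\<Prod>d\<in>#N. monom 1 g - [:d:])"
  shows "M = N"
proof (rule prod_mset_linear_factors_inject)
  have *: "(\<Prod>d\<in>#M. monom 1 g - [:d:]) = pcompose (\<Prod>d\<in>#M. [:- d, 1:]) (monom 1 g)" for M :: "int multiset"
  proof (induction M)
    case (add d M)
    have "pcompose [:- d, 1:] (monom 1 g) = monom 1 g - [:d:]" by (simp add: pcompose_pCons)
    then show ?case
      using add by (simp only: image_mset_add_mset prod_mset.add_mset pcompose_mult)
  qed (simp add: pcompose_1)
  have "pcompose ((\<Prod>d\<in>#M. [:- d, 1:]) - (\<Prod>d\<in>#N. [:- d, 1:])) (monom 1 g) = 0"
    using eq by (simp add: * pcompose_diff)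
  then have "(\<Prod>d\<in>#M. [:- d, 1:]) - (\<Prod>d\<in>#N. [:- d, 1:]) = 0"
    by (rule pcompose_eq_0) (use \<open>g > 0\<close> in \<open>simp add: degree_monom_eq\<close>)
  then show "(\<Prod>d\<in>#M. [:- d, 1:]) = (\<Prod>d\<in>#N. [:- d, 1:])" by simp
qed

text \<open>Exponents 0 contribute factors t^g, which absorb the power of t in
  \<open>factor_exp\<close>, so one product runs over all of \<open>M\<close>. The premise makes the
  truncated subtraction in the definition exact.\<close>

lemma factor_exp_iff:
  fixes C :: "'g::finite set"
  assumes "rkA C S A \<le> ellA C S"
  shows "factor_exp C S A M \<longleftrightarrow> (\<forall>d\<in>#M. d \<ge> 0) \<and> size M = ellA C S \<and>
     rkA C S A + count M 0 = ellA C S \<and> charpoly C S A = (\<Prod>d\<in>#M. monom 1 CARD('g) - [:d:])"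
    (is "_ \<longleftrightarrow> ?R")
proof
  have rep: "(\<Prod>d\<in>#replicate_mset n (0::int). monom 1 CARD('g) - [:d:]) = monom 1 (CARD('g) * n)" for n
    by (simp add: monom_power)
  have rl: "(\<Prod>d\<leftarrow>ds. monom 1 CARD('g) - [:d:]) = (\<Prod>d\<in>#mset ds. monom 1 CARD('g) - [:d:])" for ds :: "int list"
    by (metis mset_map prod_mset_prod_list)
  show ?R if fe: "factor_exp C S A M"
  proof -
    obtain ds where ds: "length ds = rkA C S A" "\<forall>d\<in>set ds. d > 0"
      "charpoly C S A = monom 1 (CARD('g) * (ellA C S - rkA C S A)) * (\<Prod>d \<leftarrow> ds. monom 1 CARD('g) - [:d:])"
      "M = replicate_mset (ellA C S - rkA C S A) 0 + mset ds"
      using fe unfolding factor_exp_def by blast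
    have "0 \<notin> set ds" using ds(2) by blast
    then have "count (mset ds) 0 = 0" by (simp add: count_eq_zero_iff)
    moreover have "\<forall>d\<in>#M. d \<ge> 0" using ds(2) unfolding ds(4) by (auto intro: less_imp_le)
    moreover have "charpoly C S A = (\<Prod>d\<in>#M. monom 1 CARD('g) - [:d:])"
      unfolding ds(3,4) image_mset_union prod_mset.union rep rl ..
    ultimately show ?thesis using ds(1,4) assms by auto
  qed
  show "factor_exp C S A M" if R: ?R
  proof -
    obtain ds where ds: "mset ds = filter_mset (\<lambda>d. d \<noteq> 0) M" using ex_mset by blast
    have "M = filter_mset (\<lambda>d. d = 0) M + filter_mset (\<lambda>d. d \<noteq> 0) M"
      by (rule multiset_partition)
    moreover have "filter_mset (\<lambda>d. d = 0) M = replicate_mset (count M 0) 0"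
      by (simp add: filter_eq_replicate_mset)
    ultimately have M: "M = replicate_mset (count M 0) 0 + mset ds" using ds by simp
    have c: "count M 0 = ellA C S - rkA C S A" using R by linarith
    have M': "M = replicate_mset (ellA C S - rkA C S A) 0 + mset ds" using M c by simp
    have "size M = count M 0 + length ds" by (subst M) simp
    then have "length ds = rkA C S A" using R by linarith
    moreover have "\<forall>d\<in>set ds. d > 0"
    proof
      fix d assume "d \<in> set ds"
      then have "d \<in># filter_mset (\<lambda>d. d \<noteq> 0) M" using ds by (metis set_mset_mset)
      then show "d > 0" using R by (auto simp: less_le)
    qed
    moreover have "charpoly C S A = monom 1 (CARD('g) * (ellA C S - rkA C S A)) * (\<Prod>d \<leftarrow> ds. monom 1 CARD('g) - [:d:])"
    proof -
      have "charpoly C S A = (\<Prod>d\<in>#M. monom 1 CARD('g) - [:d:])" using R by blast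
      then show ?thesis using M' by (metis image_mset_union prod_mset.union rep rl)
    qed
    ultimately show ?thesis unfolding factor_exp_def using M' by blast
  qed
qed

section \<open>Components of intersections of hypertori\<close>

text \<open>Evaluation at \<open>\<alpha>\<close> lifted to the universal cover, where it is
  linear.\<close>

definition pairing :: "int^'l \<Rightarrow> real^'g^'l \<Rightarrow> real^'g" where
  "pairing \<alpha> v = (\<chi> j. \<Sum>i\<in>UNIV. of_int (\<alpha>$i) * v$i$j)"

text \<open>The direction of the affine subspaces that cover the components of an intersection of
  hypertori with characters \<open>\<Phi>\<close>.\<close>

definition annih :: "(int^'l) set \<Rightarrow> (real^'g^'l) set" where
  "annih \<Phi> = {v. \<forall>\<alpha>\<in>\<Phi>. pairing \<alpha> v = 0}"

definition locus :: "'g set \<Rightarrow> ((int^'l) \<times> (complex^'g)) set \<Rightarrow> (complex^'g^'l) set" where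
  "locus C F = Tor C \<inter> \<Inter>((\<lambda>(alpha, c). Hyp C alpha c) ` F)"

lemma linear_pairing: "linear (pairing \<alpha>)"
  by (rule linearI)
    (simp_all add: pairing_def vec_eq_iff sum.distrib sum_distrib_left algebra_simps)

lemma subspace_annih: "subspace (annih \<Phi>)"
  unfolding subspace_def annih_def
  by (auto simp: linear_0[OF linear_pairing] linear_add[OF linear_pairing] linear_cmul[OF linear_pairing])

lemma evalc_Ecov:
  "evalc C (Ecov C x) \<alpha> $ j =
     (if j \<in> C then cis (2 * pi * pairing \<alpha> x $ j) else of_real (pairing \<alpha> x $ j))"
proof -
  have "(\<Prod>i\<in>I. cis (f i)) = cis (\<Sum>i\<in>I. f i)" if "finite I" for f and I :: "'b set"
    using that by (induction I) (simp_all add: cis_mult)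
  then show ?thesis
    by (simp add: evalc_def Ecov_def pairing_def cis_power_int sum_distrib_left algebra_simps)
qed

text \<open>The map from a to \<open>cis (2 * pi * a)\<close> has the integers as kernel, so a
  circle coordinate fixes the pairing modulo 1 and a real coordinate fixes it exactly.\<close>

lemma evalc_Ecov_eq_iff:
  "evalc C (Ecov C x) \<alpha> = evalc C (Ecov C y) \<alpha> \<longleftrightarrow>
     (\<forall>j. if j \<in> C then pairing \<alpha> (x - y) $ j \<in> \<int> else pairing \<alpha> (x - y) $ j = 0)"
proof -
  have "cis (2 * pi * a) = cis (2 * pi * b) \<longleftrightarrow> a - b \<in> \<int>" for a b
  proof -
    have "cis (2 * pi * a) = cis (2 * pi * b) \<longleftrightarrow> cis (2 * pi * (a - b)) = 1"
      by (simp add: right_diff_distrib flip: cis_divide)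
    also have "\<dots> \<longleftrightarrow> a - b \<in> \<int>"
    proof
      assume "cis (2 * pi * (a - b)) = 1"
      then have "cos (2 * pi * (a - b)) = 1" by (simp add: complex_eq_iff)
      then obtain n :: int where "2 * pi * (a - b) = of_int n * 2 * pi"
        using cos_one_2pi_int by blast
      then have "2 * pi * (a - b) = 2 * pi * of_int n" by (simp only: mult_ac)
      then have "a - b = of_int n" unfolding mult_cancel_left by simp
      then show "a - b \<in> \<int>" by simp
    qed simp
    finally show ?thesis .
  qed
  then show ?thesis by (auto simp: vec_eq_iff evalc_Ecov linear_diff[OF linear_pairing])
qed

lemma Ecov_in_Tor: "Ecov C x \<in> Tor C"
  by (simp add: Ecov_def Tor_def Gset_def)

lemma continuous_on_Ecov: "continuous_on U (Ecov C)"
  unfolding Ecov_def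
proof (intro continuous_on_vec_lambda)
  fix i j
  show "continuous_on U (\<lambda>x. if j \<in> C then cis (2 * pi * x$i$j) else complex_of_real (x$i$j))"
    by (cases "j \<in> C") (simp_all add: cis_conv_exp, intro continuous_intros, intro continuous_intros)
qed

text \<open>\<open>Ecov\<close> is a group homomorphism.\<close>

lemma Ecov_add_cong: "Ecov C x = Ecov C y \<Longrightarrow> Ecov C (x + v) = Ecov C (y + v)"
  by (auto simp: Ecov_def vec_eq_iff distrib_left simp flip: cis_mult split: if_splits)

text \<open>A right inverse of the covering map on \<open>Tor C\<close>, normalised at
  \<open>x\<close>. Dividing by the base point first keeps the branch cut of \<open>Arg\<close> away
  from it, which gives continuity at \<open>Ecov C x\<close>.\<close>

definition local_lift :: "'g set \<Rightarrow> real^'g^'l \<Rightarrow> complex^'g^'l \<Rightarrow> real^'g^'l" where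
  "local_lift C x \<phi> = (\<chi> i j. if j \<in> C then x$i$j + Arg (\<phi>$i$j / Ecov C x $i$j) / (2 * pi) else Re (\<phi>$i$j))"

lemma Ecov_local_lift:
  assumes "\<phi> \<in> Tor C"
  shows "Ecov C (local_lift C x \<phi>) = \<phi>"
proof -
  have "cis (2 * pi * (a + Arg (z / cis (2 * pi * a)) / (2 * pi))) = z" if "cmod z = 1" for a z
  proof -
    have "cis (Arg (z / cis (2 * pi * a))) = z / cis (2 * pi * a)"
      using that by (subst cis_Arg) (auto simp: sgn_div_norm norm_divide)
    then show ?thesis by (simp add: distrib_left flip: cis_mult)
  qed
  then show ?thesis
    using assms by (auto simp: Ecov_def local_lift_def vec_eq_iff Tor_def Gset_def)
qed

lemma local_lift_Ecov: "local_lift C x (Ecov C x) = x"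
  by (simp add: local_lift_def vec_eq_iff Ecov_def)

lemma isCont_local_lift: "isCont (local_lift C x) (Ecov C x)"
  unfolding isCont_def local_lift_Ecov unfolding local_lift_def
proof (rule vec_tendstoI, rule vec_tendstoI)
  fix i j
  have c: "((\<lambda>\<phi>. \<phi>$i$j) \<longlongrightarrow> Ecov C x $i$j) (at (Ecov C x))"
    by (intro tendsto_vec_nth tendsto_ident_at)
  show "((\<lambda>\<phi>. (\<chi> i j. if j \<in> C then x$i$j + Arg (\<phi>$i$j / Ecov C x $i$j) / (2 * pi)
      else Re (\<phi>$i$j)) $ i $ j) \<longlongrightarrow> x $ i $ j) (at (Ecov C x))"
  proof (cases "j \<in> C")
    case True
    have nz: "Ecov C x $i$j \<noteq> 0" using True by (simp add: Ecov_def)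
    have "((\<lambda>\<phi>. \<phi>$i$j / Ecov C x $i$j) \<longlongrightarrow> 1) (at (Ecov C x))"
      using tendsto_divide[OF c tendsto_const nz] nz by simp
    moreover have "isCont Arg 1" by (rule continuous_at_Arg) simp
    ultimately have "((\<lambda>\<phi>. Arg (\<phi>$i$j / Ecov C x $i$j)) \<longlongrightarrow> Arg 1) (at (Ecov C x))"
      by (rule isCont_tendsto_compose[rotated])
    then have "((\<lambda>\<phi>. x$i$j + Arg (\<phi>$i$j / Ecov C x $i$j) / (2 * pi)) \<longlongrightarrow> x$i$j + 0 / (2*pi)) (at (Ecov C x))"
      by (intro tendsto_intros) auto
    then show ?thesis using True by simp
  next
    case False
    then show ?thesis using tendsto_Re[OF c] by (simp add: Ecov_def)
  qed
qed

section \<open>Components as cosets of connected subgroups\<close>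

definition tcoset :: "'g set \<Rightarrow> (int^'l) set \<Rightarrow> real^'g^'l \<Rightarrow> (complex^'g^'l) set" where
  "tcoset C \<Phi> x = Ecov C ` ((+) x ` annih \<Phi>)"

lemma tcoset_refl: "Ecov C x \<in> tcoset C \<Phi> x"
  using subspace_0[OF subspace_annih] unfolding tcoset_def by (force simp: image_image)

lemma connected_affine_annih: "connected ((+) x ` annih \<Phi>)"
  by (intro convex_connected convex_translation subspace_imp_convex subspace_annih)

lemma connected_tcoset: "connected (tcoset C \<Phi> x)"
  unfolding tcoset_def
  by (intro connected_continuous_image continuous_on_Ecov connected_affine_annih)

lemma tcoset_eq:
  assumes "Ecov C y \<in> tcoset C \<Phi> x"
  shows "tcoset C \<Phi> y = tcoset C \<Phi> x"
proof -
  obtain v where v: "v \<in> annih \<Phi>" "Ecov C y = Ecov C (x + v)"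
    using assms by (auto simp: tcoset_def)
  have *: "Ecov C (y + u) = Ecov C (x + (v + u))" for u
    using Ecov_add_cong[OF v(2), of u] by (simp add: add.assoc)
  have "Ecov C (y + u) \<in> tcoset C \<Phi> x" if "u \<in> annih \<Phi>" for u
    unfolding * tcoset_def using that v(1) by (intro imageI subspace_add[OF subspace_annih])
  moreover have "Ecov C (x + u) \<in> tcoset C \<Phi> y" if "u \<in> annih \<Phi>" for u
  proof -
    have "Ecov C (x + u) = Ecov C (y + (u - v))" unfolding * by simp
    then show ?thesis
      unfolding tcoset_def using that v(1) by (metis imageI subspace_diff subspace_annih)
  qed
  ultimately show ?thesis by (auto simp: tcoset_def)
qed

lemma Ecov_in_locus_iff:
  "Ecov C x \<in> locus C F \<longleftrightarrow> (\<forall>(\<alpha>, c)\<in>F. evalc C (Ecov C x) \<alpha> = c)"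
  by (auto simp: locus_def Hyp_def Ecov_in_Tor)

text \<open>Both points give \<open>\<alpha>\<close> the same value. Openness of cosets, the lifts
  of components and finiteness all rest on this integrality.\<close>

lemma locus_pairing_Ints:
  assumes "Ecov C x \<in> locus C F" "Ecov C y \<in> locus C F" "\<alpha> \<in> fst ` F"
  shows "pairing \<alpha> (x - y) $ j \<in> \<int>"
proof -
  have "evalc C (Ecov C x) \<alpha> = evalc C (Ecov C y) \<alpha>"
    using assms by (fastforce simp: Ecov_in_locus_iff)
  then show ?thesis using evalc_Ecov_eq_iff[of C x \<alpha> y] Ints_0 by metis
qed

lemma evalc_add_annih:
  assumes "pairing \<alpha> v = 0"
  shows "evalc C (Ecov C (x + v)) \<alpha> = evalc C (Ecov C x) \<alpha>"
  using assms by (simp add: evalc_Ecov_eq_iff)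

lemma tcoset_subset_locus:
  assumes "Ecov C x \<in> locus C F"
  shows "tcoset C (fst ` F) x \<subseteq> locus C F"
  using assms unfolding tcoset_def
  by (force simp: Ecov_in_locus_iff annih_def evalc_add_annih)

text \<open>A point of the locus close to \<open>Ecov C y\<close> has a lift close to
  \<open>y\<close>, whose pairings differ from those of \<open>y\<close> by integers of absolute
  value below 1, that is by 0. Finiteness of \<open>F\<close> gives one radius for all
  characters.\<close>

lemma openin_tcoset:
  assumes fin: "finite F" and x: "Ecov C x \<in> locus C F"
  shows "openin (top_of_set (locus C F)) (tcoset C (fst ` F) x)"
  unfolding openin_euclidean_subtopology_iff
proof (intro conjI ballI)
  show "tcoset C (fst ` F) x \<subseteq> locus C F" using x by (rule tcoset_subset_locus)
  fix \<psi> assume psi: "\<psi> \<in> tcoset C (fst ` F) x"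
  then obtain y where y: "\<psi> = Ecov C y" by (auto simp: tcoset_def)
  have yF: "Ecov C y \<in> locus C F" using psi y tcoset_subset_locus[OF x] by auto
  have lim: "((\<lambda>\<phi>. pairing \<alpha> (local_lift C y \<phi> - y) $ j) \<longlongrightarrow> 0) (nhds (Ecov C y))" for \<alpha> j
  proof -
    let ?f = "\<lambda>\<phi>. pairing \<alpha> (local_lift C y \<phi> - y) $ j"
    have "isCont ?f (Ecov C y)"
      unfolding pairing_def vec_lambda_beta vector_minus_component
      by (intro continuous_intros isCont_local_lift)
    then have "(?f \<longlongrightarrow> ?f (Ecov C y)) (nhds (Ecov C y))"
      unfolding isCont_def using tendsto_at_iff_tendsto_nhds[of ?f] by blast
    then show ?thesis by (simp add: local_lift_Ecov linear_0[OF linear_pairing])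
  qed
  have "\<forall>\<^sub>F \<phi> in nhds (Ecov C y). \<forall>\<alpha>\<in>fst ` F. \<forall>j\<in>UNIV. \<bar>pairing \<alpha> (local_lift C y \<phi> - y) $ j\<bar> < 1"
  proof (intro eventually_ball_finite ballI)
    fix \<alpha> j
    show "\<forall>\<^sub>F \<phi> in nhds (Ecov C y). \<bar>pairing \<alpha> (local_lift C y \<phi> - y) $ j\<bar> < 1"
      using tendstoD[OF lim, of 1] by (simp add: dist_norm)
  qed (use fin in auto)
  then obtain d where d: "d > 0" "\<And>\<phi> \<alpha> j. dist \<phi> (Ecov C y) < d \<Longrightarrow> \<alpha> \<in> fst ` F \<Longrightarrow>
      \<bar>pairing \<alpha> (local_lift C y \<phi> - y) $ j\<bar> < 1"
    unfolding eventually_nhds_metric by blast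
  show "\<exists>e>0. \<forall>\<phi>\<in>locus C F. dist \<phi> \<psi> < e \<longrightarrow> \<phi> \<in> tcoset C (fst ` F) x"
  proof (intro exI[of _ d] conjI ballI impI d(1))
    fix \<phi> assume p: "\<phi> \<in> locus C F" "dist \<phi> \<psi> < d"
    let ?z = "local_lift C y \<phi>"
    have E: "Ecov C ?z = \<phi>" using p(1) by (intro Ecov_local_lift) (simp add: locus_def)
    have "pairing \<alpha> (?z - y) $ j = 0" if "\<alpha> \<in> fst ` F" for \<alpha> j
      using locus_pairing_Ints[of C ?z F y \<alpha> j] d(2)[of \<phi> \<alpha> j] E p that yF y
      by (intro Ints_nonzero_abs_less1) simp_all
    then have "?z - y \<in> annih (fst ` F)" by (auto simp: annih_def vec_eq_iff)
    then have "y + (?z - y) \<in> (+) y ` annih (fst ` F)" by (rule imageI)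
    then have "\<phi> \<in> tcoset C (fst ` F) y" unfolding tcoset_def using E by force
    then show "\<phi> \<in> tcoset C (fst ` F) x" using tcoset_eq psi y by metis
  qed
qed

text \<open>The cosets inside \<open>X\<close> are open and pairwise equal or disjoint, so the
  complement of one is a union of others. Each is therefore clopen in the connected set
  \<open>X\<close>.\<close>

lemma locus_component_eq_tcoset:
  assumes fin: "finite F" and X: "X \<in> components (locus C F)" and x: "Ecov C x \<in> X"
  shows "X = tcoset C (fst ` F) x"
proof -
  let ?O = "tcoset C (fst ` F)"
  have XF: "X \<subseteq> locus C F" using in_components_subset[OF X] .
  have sub: "?O y \<subseteq> X" if "Ecov C y \<in> X" for y
    by (rule components_maximal[OF X connected_tcoset])
       (use that XF tcoset_subset_locus[of C y F] tcoset_refl[of C y "fst ` F"] in blast)+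
  have op: "openin (top_of_set X) (?O y)" if "Ecov C y \<in> X" for y
    by (rule openin_subset_trans[OF openin_tcoset[OF fin, of C y] sub XF]) (use that XF in blast)+
  have "X - ?O x = \<Union>{?O y | y. Ecov C y \<in> X - ?O x}" (is "_ = \<Union>?U")
  proof (intro equalityI subsetI)
    fix \<phi> assume p: "\<phi> \<in> X - ?O x"
    then have "\<phi> \<in> Tor C" using XF by (auto simp: locus_def)
    then have "Ecov C (local_lift C 0 \<phi>) = \<phi>" by (rule Ecov_local_lift)
    then show "\<phi> \<in> \<Union>?U" using p tcoset_refl[of C "local_lift C 0 \<phi>" "fst ` F"] by force
  next
    fix \<phi> assume "\<phi> \<in> \<Union>?U"
    then obtain y where y: "Ecov C y \<in> X" "Ecov C y \<notin> ?O x" "\<phi> \<in> ?O y" by blast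
    then have "\<phi> \<in> X" using sub by blast
    moreover have "\<phi> \<notin> ?O x"
    proof
      assume a: "\<phi> \<in> ?O x"
      obtain z where "\<phi> = Ecov C z" using y(3) by (auto simp: tcoset_def)
      then have "?O x = ?O y" using tcoset_eq a y(3) by metis
      then show False using y(2) tcoset_refl by metis
    qed
    ultimately show "\<phi> \<in> X - ?O x" by blast
  qed
  moreover have "openin (top_of_set X) (\<Union>?U)" using op by (intro openin_Union) auto
  ultimately have "openin (top_of_set X) (X - ?O x)" by (rule ssubst)
  then have "closedin (top_of_set X) (?O x)"
    using sub[OF x] unfolding closedin_def by simp
  then show ?thesis
    using in_components_connected[OF X] op[OF x] tcoset_refl[of C x "fst ` F"]
    unfolding connected_clopen by blast
qed

section \<open>Lifts of components and their dimension\<close>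

text \<open>On a connected part of the preimage each pairing is continuous with values differing by
  integers, hence constant.\<close>

lemma component_Ecov_preimage:
  assumes fin: "finite F" and X: "X \<in> components (locus C F)" and x: "Ecov C x \<in> X"
  shows "connected_component_set (Ecov C -` X) x = (+) x ` annih (fst ` F)"
proof (rule connected_component_unique)
  show "x \<in> (+) x ` annih (fst ` F)" using subspace_0[OF subspace_annih] by force
  show "(+) x ` annih (fst ` F) \<subseteq> Ecov C -` X"
    using locus_component_eq_tcoset[OF assms] by (auto simp: tcoset_def)
  show "connected ((+) x ` annih (fst ` F))" by (rule connected_affine_annih)
  fix T assume T: "x \<in> T" "T \<subseteq> Ecov C -` X" "connected T"
  have inF: "Ecov C y \<in> locus C F" if "y \<in> T" for y
    using T(2) that in_components_subset[OF X] by blast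
  show "T \<subseteq> (+) x ` annih (fst ` F)"
  proof
    fix y assume y: "y \<in> T"
    have "pairing \<alpha> y $ j = pairing \<alpha> x $ j" if a: "\<alpha> \<in> fst ` F" for \<alpha> j
    proof -
      have "(\<lambda>y. pairing \<alpha> y $ j) constant_on T"
      proof (rule continuous_discrete_range_constant[OF T(3)])
        show "continuous_on T (\<lambda>y. pairing \<alpha> y $ j)"
          unfolding pairing_def vec_lambda_beta by (intro continuous_intros)
        fix u assume u: "u \<in> T"
        have "1 \<le> norm (pairing \<alpha> w $ j - pairing \<alpha> u $ j)"
          if "w \<in> T" "pairing \<alpha> w $ j \<noteq> pairing \<alpha> u $ j" for w
          using locus_pairing_Ints[OF inF[OF that(1)] inF[OF u] a, of j] that(2)
            Ints_nonzero_abs_less1[of "pairing \<alpha> w $ j - pairing \<alpha> u $ j"]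
          by (force simp: linear_diff[OF linear_pairing])
        then show "\<exists>e>0. \<forall>w. w \<in> T \<and> pairing \<alpha> w $ j \<noteq> pairing \<alpha> u $ j
            \<longrightarrow> e \<le> norm (pairing \<alpha> w $ j - pairing \<alpha> u $ j)"
          by (intro exI[of _ 1]) auto
      qed
      then show ?thesis using T(1) y unfolding constant_on_def by metis
    qed
    then have "y - x \<in> annih (fst ` F)"
      by (auto simp: annih_def linear_diff[OF linear_pairing] vec_eq_iff)
    then show "y \<in> (+) x ` annih (fst ` F)" by (intro image_eqI[of _ _ "y - x"]) auto
  qed
qed

lemma aff_dim_component_Ecov_preimage:
  fixes X :: "(complex^'g::finite^'l) set"
  assumes "finite F" and "X \<in> components (locus C F)" and "Ecov C x \<in> X"
  shows "aff_dim (connected_component_set (Ecov C -` X) x) = int (dim (annih (fst ` F) :: (real^'g^'l) set))"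
  unfolding component_Ecov_preimage[OF assms] aff_dim_translation_eq
  by (rule aff_dim_subspace[OF subspace_annih])

lemma locus_component_Ecov:
  assumes "X \<in> components (locus C F)"
  obtains x where "Ecov C x \<in> X"
proof -
  obtain \<phi> where "\<phi> \<in> X" using in_components_nonempty[OF assms] by blast
  moreover have "X \<subseteq> Tor C" using in_components_subset[OF assms] by (auto simp: locus_def)
  ultimately have "Ecov C (local_lift C 0 \<phi>) \<in> X" using Ecov_local_lift by fastforce
  then show thesis by (rule that)
qed

lemma dimR_locus_component:
  fixes X :: "(complex^'g::finite^'l) set"
  assumes "finite F" and "X \<in> components (locus C F)"
  shows "dimR C X = int (dim (annih (fst ` F) :: (real^'g^'l) set))"
proof -
  obtain x where "Ecov C x \<in> X" using locus_component_Ecov[OF assms(2)] .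
  \<comment> \<open>The base point picked by \<open>SOME\<close> is immaterial, since the lift has
    the same affine dimension at every point over \<open>X\<close>.\<close>
  then have "Ecov C (SOME x. Ecov C x \<in> X) \<in> X" by (rule someI)
  then show ?thesis unfolding dimR_def by (rule aff_dim_component_Ecov_preimage[OF assms])
qed

text \<open>Rank and nullity on a subspace: \<open>f\<close> is injective on the orthogonal
  complement of its kernel within \<open>V\<close> and maps it onto the image of
  \<open>V\<close>.\<close>

lemma dim_kernel_image_subspace:
  fixes f :: "'a::euclidean_space \<Rightarrow> 'b::euclidean_space"
  assumes V: "subspace V" and f: "linear f"
  shows "dim {v \<in> V. f v = 0} + dim (f ` V) = dim V"
proof -
  let ?K = "{v \<in> V. f v = 0}"
  let ?N = "{y \<in> V. \<forall>x\<in>?K. orthogonal x y}"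
  have K: "subspace ?K"
    using V f by (auto simp: subspace_def linear_0 linear_add linear_cmul)
  have N: "subspace ?N"
    using V by (auto simp: subspace_def orthogonal_def inner_add_right)
  have sum: "dim ?N + dim ?K = dim V"
    using dim_subspace_orthogonal_to_vectors[OF K V] by auto
  have inj: "inj_on f (span ?N)"
    unfolding span_eq_iff[THEN iffD2, OF N]
  proof (rule inj_onI)
    fix x y assume a: "x \<in> ?N" "y \<in> ?N" "f x = f y"
    then have d: "x - y \<in> ?N" using subspace_diff[OF N] by blast
    then have "x - y \<in> ?K" using a(3) by (simp add: linear_diff[OF f])
    then have "orthogonal (x - y) (x - y)" using d by blast
    then show "x = y" by (simp add: orthogonal_def)
  qed
  have "f ` V = f ` ?N"
  proof
    show "f ` V \<subseteq> f ` ?N"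
    proof clarify
      fix v assume v: "v \<in> V"
      obtain k n where kn: "k \<in> span ?K" "\<And>w. w \<in> span ?K \<Longrightarrow> orthogonal n w" "v = k + n"
        by (rule orthogonal_subspace_decomp_exists[of ?K v]) blast
      have sK: "span ?K = ?K" using K by (simp only: span_eq_iff)
      then have k: "k \<in> ?K" using kn(1) by (simp only:)
      have "n = v - k" using kn(3) by simp
      then have "n \<in> V" using v k subspace_diff[OF V] by blast
      moreover have "\<forall>w\<in>?K. orthogonal w n"
        using kn(2) unfolding sK by (metis orthogonal_commute)
      ultimately have "n \<in> ?N" by blast
      moreover have "f v = f n" using kn(3) k by (simp add: linear_add[OF f])
      ultimately show "f v \<in> f ` ?N" by blast
    qed
  qed auto
  then have "dim (f ` V) = dim ?N" using dim_image_eq[OF f inj] by simp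
  then show ?thesis using sum by simp
qed

text \<open>\<open>annih \<Phi>\<close> is a \<open>g\<close>-fold power of a subspace of \<open>\<real>\<^sup>\<ell>\<close>, so a single functional that does not
vanish on it maps it onto all of \<open>\<real>\<^sup>g\<close>.\<close>
lemma dim_annih_insert:
  fixes \<alpha> :: "int^'l"
  assumes "v \<in> (annih \<Phi> :: (real^'g::finite^'l) set)" and "pairing \<alpha> v \<noteq> 0"
  shows "dim (annih (insert \<alpha> \<Phi>) :: (real^'g^'l) set) + CARD('g) = dim (annih \<Phi> :: (real^'g^'l) set)"
proof -
  let ?V = "annih \<Phi> :: (real^'g^'l) set"
  obtain j0 where j0: "pairing \<alpha> v $ j0 \<noteq> 0" using assms(2) by (auto simp: vec_eq_iff)
  have "u \<in> pairing \<alpha> ` ?V" for u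
  proof
    \<comment> \<open>Every slice of the witness is a multiple of the slice \<open>j0\<close> of
      \<open>v\<close>, so it stays in the annihilator; the scalars make its pairing with
      \<open>\<alpha>\<close> equal to \<open>u\<close>.\<close>
    let ?w = "(\<chi> i j. v$i$j0 * (u$j / pairing \<alpha> v $ j0)) :: real^'g^'l"
    have *: "pairing \<beta> ?w $ j = pairing \<beta> v $ j0 * (u$j / pairing \<alpha> v $ j0)" for \<beta> j
      by (simp only: pairing_def vec_lambda_beta sum_distrib_right mult.assoc)
    show "u = pairing \<alpha> ?w" using j0 unfolding vec_eq_iff * by simp
    show "?w \<in> ?V" using assms(1) unfolding annih_def mem_Collect_eq vec_eq_iff * by simp
  qed
  then have "pairing \<alpha> ` ?V = UNIV" by blast
  moreover have "annih (insert \<alpha> \<Phi>) = {v \<in> ?V. pairing \<alpha> v = 0}" by (auto simp: annih_def)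
  ultimately show ?thesis
    using dim_kernel_image_subspace[OF subspace_annih[of \<Phi>, where ?'a='g] linear_pairing[of \<alpha>]] by simp
qed

text \<open>The full space has dimension divisible by g, and adding a functional either lowers the
  dimension by g or changes nothing.\<close>

lemma CARD_dvd_dim_annih:
  assumes "finite \<Phi>"
  shows "CARD('g) dvd dim (annih \<Phi> :: (real^'g::finite^'l) set)"
  using assms
proof induction
  case empty
  then show ?case by (simp add: annih_def)
next
  case (insert \<alpha> \<Phi>)
  show ?case
  proof (cases "\<exists>v\<in>(annih \<Phi> :: (real^'g^'l) set). pairing \<alpha> v \<noteq> 0")
    case True
    then show ?thesis using dim_annih_insert[of _ \<Phi> \<alpha>] insert by (metis dvd_add_left_iff dvd_refl)
  next
    case False
    then have "annih (insert \<alpha> \<Phi>) = (annih \<Phi> :: (real^'g^'l) set)" by (auto simp: annih_def)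
    then show ?thesis using insert by simp
  qed
qed

section \<open>Finiteness of the set of components\<close>

text \<open>Each component is the coset of a point in the box \<open>Q\<close> around
  \<open>x0\<close>. On the box the pairings are bounded, and their integer parts \<open>h\<close>
  determine the coset.\<close>

lemma finite_components_locus:
  fixes C :: "'g::finite set" and F :: "((int^'l) \<times> (complex^'g)) set"
  assumes fin: "finite F"
  shows "finite (components (locus C F))"
proof (cases "locus C F = {}")
  case False
  then obtain X0 where "X0 \<in> components (locus C F)" by fastforce
  then obtain x0 where x0: "Ecov C x0 \<in> locus C F"
    using locus_component_Ecov in_components_subset by (metis subset_iff)
  let ?\<Phi> = "fst ` F"
  define Q where "Q = {x. Ecov C x \<in> locus C F \<and> (\<forall>i j. \<bar>x$i$j - x0$i$j\<bar> \<le> 1)}"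
  define h where "h x = (\<lambda>(\<alpha>, j)\<in>?\<Phi> \<times> UNIV. \<lfloor>pairing \<alpha> (x - x0) $ j\<rfloor>)" for x
  define N where "N \<alpha> = (\<Sum>i\<in>UNIV. \<bar>\<alpha>$i\<bar>)" for \<alpha> :: "int^'l"
  have "h ` Q \<subseteq> (\<Pi>\<^sub>E (\<alpha>, j)\<in>?\<Phi> \<times> UNIV. {- N \<alpha>..N \<alpha>})"
  proof clarify
    fix x assume x: "x \<in> Q"
    have "\<bar>pairing \<alpha> (x - x0) $ j\<bar> \<le> real_of_int (N \<alpha>)" for \<alpha> j
    proof -
      have "\<bar>pairing \<alpha> (x - x0) $ j\<bar> \<le> (\<Sum>i\<in>UNIV. \<bar>of_int (\<alpha>$i) * (x - x0)$i$j\<bar>)"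
        unfolding pairing_def vec_lambda_beta by (rule sum_abs)
      also have "\<dots> \<le> (\<Sum>i\<in>UNIV. \<bar>real_of_int (\<alpha>$i)\<bar> * 1)"
        unfolding abs_mult by (intro sum_mono mult_left_mono) (use x in \<open>auto simp: Q_def\<close>)
      finally show ?thesis by (simp add: N_def)
    qed
    then have "- N \<alpha> \<le> \<lfloor>pairing \<alpha> (x - x0) $ j\<rfloor> \<and> \<lfloor>pairing \<alpha> (x - x0) $ j\<rfloor> \<le> N \<alpha>" for \<alpha> j
      by (smt (verit, ccfv_SIG) floor_le_iff le_floor_iff of_int_minus)
    then show "h x \<in> (\<Pi>\<^sub>E (\<alpha>, j)\<in>?\<Phi> \<times> UNIV. {- N \<alpha>..N \<alpha>})"
      by (auto simp: h_def PiE_iff)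
  qed
  moreover have "finite (\<Pi>\<^sub>E (\<alpha>, j)\<in>?\<Phi> \<times> (UNIV :: 'g set). {- N \<alpha>..N \<alpha>})"
    using fin by (intro finite_PiE) auto
  ultimately have "finite (h ` Q)" by (rule finite_subset)
  have same: "tcoset C ?\<Phi> x = tcoset C ?\<Phi> y" if "x \<in> Q" "y \<in> Q" "h x = h y" for x y
  proof -
    have "pairing \<alpha> (x - y) $ j = 0" if a: "\<alpha> \<in> ?\<Phi>" for \<alpha> j
    proof -
      have "\<lfloor>pairing \<alpha> (x - x0) $ j\<rfloor> = \<lfloor>pairing \<alpha> (y - x0) $ j\<rfloor>"
        using fun_cong[OF \<open>h x = h y\<close>, of "(\<alpha>, j)"] a by (simp add: h_def)
      then have "\<bar>pairing \<alpha> (x - y) $ j\<bar> < 1"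
        by (simp add: linear_diff[OF linear_pairing]) linarith
      moreover have "pairing \<alpha> (x - y) $ j \<in> \<int>"
        using \<open>x \<in> Q\<close> \<open>y \<in> Q\<close> a by (intro locus_pairing_Ints) (auto simp: Q_def)
      ultimately show ?thesis by (intro Ints_nonzero_abs_less1)
    qed
    then have "x - y \<in> annih ?\<Phi>" by (auto simp: annih_def vec_eq_iff)
    then have "Ecov C (y + (x - y)) \<in> tcoset C ?\<Phi> y" unfolding tcoset_def by (intro imageI)
    then show ?thesis by (intro tcoset_eq) simp
  qed
  \<comment> \<open>The coset of \<open>x\<close> depends only on the label \<open>h x\<close>, so
    there are at most as many cosets as labels.\<close>
  have "tcoset C ?\<Phi> ` Q \<subseteq> (\<lambda>k. tcoset C ?\<Phi> (inv_into Q h k)) ` (h ` Q)"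
  proof clarify
    fix x assume "x \<in> Q"
    then have "tcoset C ?\<Phi> x = tcoset C ?\<Phi> (inv_into Q h (h x))"
      by (intro same) (auto intro: inv_into_into simp: f_inv_into_f)
    then show "tcoset C ?\<Phi> x \<in> (\<lambda>k. tcoset C ?\<Phi> (inv_into Q h k)) ` (h ` Q)"
      using \<open>x \<in> Q\<close> by blast
  qed
  with \<open>finite (h ` Q)\<close> have "finite (tcoset C ?\<Phi> ` Q)"
    by (meson finite_imageI finite_subset)
  moreover have "components (locus C F) \<subseteq> tcoset C ?\<Phi> ` Q"
  proof
    fix X assume X: "X \<in> components (locus C F)"
    obtain y where y: "Ecov C y \<in> X" using locus_component_Ecov[OF X] .
    have yF: "Ecov C y \<in> locus C F" using y in_components_subset[OF X] by blast
    text \<open>Move the circle coordinates of \<open>y\<close> within distance 1 of \<open>x0\<close>, and replace its real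
      coordinates, which do not affect the component, by those of \<open>x0\<close>.\<close>
    define z where "z = (\<chi> i j. if j \<in> C then local_lift C x0 (Ecov C y) $i$j else y$i$j)"
    define x where "x = (\<chi> i j. if j \<in> C then z$i$j else x0$i$j)"
    have Ez: "Ecov C z = Ecov C y"
      using Ecov_local_lift[OF Ecov_in_Tor, of C x0 y]
      by (auto simp: z_def Ecov_def vec_eq_iff split: if_splits)
    \<comment> \<open>\<open>x - z\<close> vanishes in the circle coordinates and equals
      \<open>x0 - y\<close> in the real ones, where two points of the locus have equal
      pairings.\<close>
    have "x - z \<in> annih ?\<Phi>"
      unfolding annih_def mem_Collect_eq vec_eq_iff
    proof (intro ballI allI)
      fix \<alpha> j assume "\<alpha> \<in> ?\<Phi>"
      then have "evalc C (Ecov C x0) \<alpha> = evalc C (Ecov C y) \<alpha>"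
        using x0 yF by (fastforce simp: Ecov_in_locus_iff)
      then have "j \<notin> C \<Longrightarrow> pairing \<alpha> (x0 - y) $ j = 0" unfolding evalc_Ecov_eq_iff by metis
      then show "pairing \<alpha> (x - z) $ j = 0 $ j"
        by (cases "j \<in> C") (simp_all add: pairing_def x_def z_def)
    qed
    then have "Ecov C (z + (x - z)) \<in> tcoset C ?\<Phi> z" unfolding tcoset_def by (intro imageI)
    then have xX: "Ecov C x \<in> X"
      using locus_component_eq_tcoset[OF fin X, of z] y Ez by simp
    have "\<bar>Arg w / (2 * pi)\<bar> \<le> 1" for w
      using Arg_bounded[of w] by (simp add: abs_le_iff field_simps)
    then have "x \<in> Q"
      using xX in_components_subset[OF X] by (auto simp: Q_def x_def z_def local_lift_def)
    then show "X \<in> tcoset C ?\<Phi> ` Q" using locus_component_eq_tcoset[OF fin X xX] by blast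
  qed
  ultimately show ?thesis by (meson finite_subset)
qed simp

section \<open>Layers\<close>

text \<open>A connected subset of \<open>Z\<close> around a component of \<open>U\<close> meets
  \<open>U\<close> and so lies in it; maximality in \<open>U\<close> thus gives maximality in
  \<open>Z\<close>. This turns components of intersections of layers into components of
  loci.\<close>

lemma components_saturated_subset:
  assumes "U \<subseteq> Z" and sat: "\<And>T. connected T \<Longrightarrow> T \<subseteq> Z \<Longrightarrow> T \<inter> U \<noteq> {} \<Longrightarrow> T \<subseteq> U"
  shows "components U \<subseteq> components Z"
proof
  fix X assume X: "X \<in> components U"
  then have Xs: "X \<noteq> {}" "X \<subseteq> U" "connected X"
    using in_components_nonempty in_components_subset in_components_connected by blast+
  show "X \<in> components Z"
    unfolding in_components_maximal
  proof (intro conjI allI impI)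
    fix D assume D: "D \<noteq> {} \<and> X \<subseteq> D \<and> D \<subseteq> Z \<and> connected D"
    then have "D \<subseteq> U" using Xs by (intro sat) blast+
    then show "D = X" using D X unfolding in_components_maximal by blast
  qed (use Xs \<open>U \<subseteq> Z\<close> in blast)+
qed

lemma layer_iff_locus:
  "layer C S \<longleftrightarrow> (\<exists>F. finite F \<and> (\<forall>(\<alpha>, c)\<in>F. c \<in> Gset C) \<and> S \<in> components (locus C F))"
  by (simp add: layer_def locus_def)

lemma layer_connected: "layer C S \<Longrightarrow> connected S" and layer_nonempty: "layer C S \<Longrightarrow> S \<noteq> {}"
  unfolding layer_def using in_components_connected in_components_nonempty by blast+

lemma component_Int_Hyp:
  assumes S: "S \<in> components (locus C F)" and X: "X \<in> components (S \<inter> Hyp C \<alpha> c)"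
  shows "X \<in> components (locus C (insert (\<alpha>, c) F))"
proof -
  have loc: "locus C (insert (\<alpha>, c) F) = locus C F \<inter> Hyp C \<alpha> c" by (auto simp: locus_def)
  have "components (S \<inter> Hyp C \<alpha> c) \<subseteq> components (locus C F \<inter> Hyp C \<alpha> c)"
  proof (rule components_saturated_subset)
    show "S \<inter> Hyp C \<alpha> c \<subseteq> locus C F \<inter> Hyp C \<alpha> c" using in_components_subset[OF S] by blast
    fix T assume T: "connected T" "T \<subseteq> locus C F \<inter> Hyp C \<alpha> c" "T \<inter> (S \<inter> Hyp C \<alpha> c) \<noteq> {}"
    then have "T \<subseteq> S" by (intro components_maximal[OF S]) blast+
    then show "T \<subseteq> S \<inter> Hyp C \<alpha> c" using T by blast
  qed
  then show ?thesis using X loc by auto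
qed

text \<open>Pooling the families that define \<open>S\<close> and the members of \<open>B\<close>
  gives one finite family. A connected subset of its locus that meets the intersection of these
  layers lies inside it.\<close>

lemma components_Int_layers:
  assumes S: "layer C S" and B: "finite B" "\<And>K. K \<in> B \<Longrightarrow> layer C K"
  shows "finite (components (S \<inter> \<Inter>B))" and "\<And>X. X \<in> components (S \<inter> \<Inter>B) \<Longrightarrow> layer C X"
proof -
  have "\<forall>K\<in>insert S B. \<exists>F. finite F \<and> (\<forall>(\<alpha>, c)\<in>F. c \<in> Gset C) \<and> K \<in> components (locus C F)"
    using S B(2) unfolding layer_iff_locus by blast
  then obtain F where F: "\<And>K. K \<in> insert S B \<Longrightarrow>
      finite (F K) \<and> (\<forall>(\<alpha>, c)\<in>F K. c \<in> Gset C) \<and> K \<in> components (locus C (F K))"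
    by metis
  let ?G = "\<Union>(F ` insert S B)"
  have loc: "locus C ?G = \<Inter>((\<lambda>K. locus C (F K)) ` insert S B)" by (auto simp: locus_def)
  have sub: "components (\<Inter>(insert S B)) \<subseteq> components (locus C ?G)"
    unfolding loc
  proof (rule components_saturated_subset)
    show "\<Inter>(insert S B) \<subseteq> \<Inter>((\<lambda>K. locus C (F K)) ` insert S B)"
    proof (rule INT_greatest)
      fix K assume K: "K \<in> insert S B"
      then have "K \<subseteq> locus C (F K)" using F in_components_subset by blast
      then show "\<Inter>(insert S B) \<subseteq> locus C (F K)" using K by blast
    qed
    fix T assume T: "connected T" "T \<subseteq> \<Inter>((\<lambda>K. locus C (F K)) ` insert S B)" "T \<inter> \<Inter>(insert S B) \<noteq> {}"
    show "T \<subseteq> \<Inter>(insert S B)"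
    proof (rule Inter_greatest)
      fix K assume K: "K \<in> insert S B"
      then have "T \<subseteq> locus C (F K)" "K \<inter> T \<noteq> {}" using T by blast+
      then show "T \<subseteq> K" using components_maximal[of K "locus C (F K)" T] F[OF K] T(1) by blast
    qed
  qed
  have fin: "finite ?G" using B(1) F by blast
  have Gs: "\<forall>(\<alpha>, c)\<in>?G. c \<in> Gset C" using F by blast
  show "finite (components (S \<inter> \<Inter>B))"
    using sub finite_components_locus[OF fin] finite_subset by auto
  show "layer C X" if "X \<in> components (S \<inter> \<Inter>B)" for X
    unfolding layer_iff_locus using sub fin Gs that by (intro exI[of _ ?G]) auto
qed

lemma layer_Ecov: "layer C X \<Longrightarrow> \<exists>x. Ecov C x \<in> X"
  unfolding layer_iff_locus using locus_component_Ecov by metis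

text \<open>Frees \<open>dimR\<close> from its chosen base point, so that layers sharing a point can
  be compared there.\<close>

lemma dimR_layer:
  assumes "layer C X" and "Ecov C x \<in> X"
  shows "dimR C X = aff_dim (connected_component_set (Ecov C -` X) x)"
  using assms dimR_locus_component aff_dim_component_Ecov_preimage
  unfolding layer_iff_locus by metis

lemma dimR_layer_dvd:
  fixes C :: "'g::finite set" and X :: "(complex^'g^'l) set"
  assumes "layer C X"
  shows "int CARD('g) dvd dimR C X" and "dimR C X \<ge> 0"
  using assms dimR_locus_component CARD_dvd_dim_annih
  unfolding layer_iff_locus by (metis finite_imageI int_dvd_int_iff, metis of_nat_0_le_iff)

lemma dimR_layer_mono:
  assumes "layer C X" "layer C Y" "X \<subseteq> Y"
  shows "dimR C X \<le> dimR C Y"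
proof -
  obtain x where x: "Ecov C x \<in> X" using layer_Ecov[OF assms(1)] by blast
  have "dimR C X = aff_dim (connected_component_set (Ecov C -` X) x)"
    by (rule dimR_layer[OF assms(1) x])
  also have "\<dots> \<le> aff_dim (connected_component_set (Ecov C -` Y) x)"
    using assms(3) by (intro aff_dim_subset connected_component_mono) auto
  also have "\<dots> = dimR C Y"
    using x assms(3) by (intro dimR_layer[OF assms(2), symmetric]) auto
  finally show ?thesis .
qed

text \<open>Lifted at a common point, the layers have nested directions of equal dimension; these
  coincide, and so do the cosets.\<close>

lemma layer_eqI_dimR:
  assumes "layer C X" "layer C Y" "X \<subseteq> Y" "dimR C X = dimR C Y"
  shows "X = Y"
proof -
  obtain F where F: "finite F" "X \<in> components (locus C F)"
    using assms(1) unfolding layer_iff_locus by blast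
  obtain G where G: "finite G" "Y \<in> components (locus C G)"
    using assms(2) unfolding layer_iff_locus by blast
  obtain x where x: "Ecov C x \<in> X" using layer_Ecov[OF assms(1)] by blast
  have xY: "Ecov C x \<in> Y" using x assms(3) by blast
  have "(+) x ` annih (fst ` F) \<subseteq> (+) x ` annih (fst ` G)"
    unfolding component_Ecov_preimage[OF F x, symmetric] component_Ecov_preimage[OF G xY, symmetric]
    using assms(3) by (intro connected_component_mono vimage_mono)
  then have sub: "(annih (fst ` F) :: (real^'a^'b) set) \<subseteq> annih (fst ` G)" by auto
  have "(annih (fst ` F) :: (real^'a^'b) set) = annih (fst ` G)"
    using dimR_locus_component[OF F] dimR_locus_component[OF G] assms(4)
    by (intro subspace_dim_equal subspace_annih sub) simp
  then show ?thesis
    using locus_component_eq_tcoset[OF F x] locus_component_eq_tcoset[OF G xY]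
    by (simp add: tcoset_def)
qed

section \<open>Members of an arrangement and bounds for its rank\<close>

text \<open>A character that is not constant on \<open>S\<close> cannot vanish on the direction of
  \<open>S\<close>, so \<open>dim_annih_insert\<close> gives a drop by exactly g.\<close>

lemma arr_member:
  fixes C :: "'g::finite set" and A :: "(complex^'g^'l) set set"
  assumes arr: "arr C S A" and K: "K \<in> A"
  shows "layer C K" and "K \<subseteq> S" and "dimR C S = dimR C K + int CARD('g)"
proof -
  obtain F where F: "finite F" "\<forall>(\<alpha>, c)\<in>F. c \<in> Gset C" "S \<in> components (locus C F)"
    using arr unfolding arr_def layer_iff_locus by blast
  obtain \<alpha> c x y where a: "c \<in> Gset C" "x \<in> S" "y \<in> S" "evalc C x \<alpha> \<noteq> evalc C y \<alpha>"
      "K \<in> components (S \<inter> Hyp C \<alpha> c)"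
    using arr K unfolding arr_def by metis
  let ?F = "insert (\<alpha>, c) F"
  have KF: "K \<in> components (locus C ?F)" using component_Int_Hyp[OF F(3) a(5)] .
  show "layer C K" unfolding layer_iff_locus using KF F(1,2) a(1) by (intro exI[of _ ?F]) auto
  show "K \<subseteq> S" using in_components_subset[OF a(5)] by blast
  obtain z where z: "Ecov C z \<in> S" using locus_component_Ecov[OF F(3)] .
  have S: "S = tcoset C (fst ` F) z" by (rule locus_component_eq_tcoset[OF F(1,3) z])
  have "\<exists>v\<in>annih (fst ` F). pairing \<alpha> (v :: real^'g^'l) \<noteq> 0"
  proof (rule ccontr)
    assume "\<not> ?thesis"
    then have "evalc C w \<alpha> = evalc C (Ecov C z) \<alpha>" if "w \<in> S" for w
      using that unfolding S tcoset_def by (auto simp: evalc_add_annih)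
    then show False using a(2-4) by metis
  qed
  then show "dimR C S = dimR C K + int CARD('g)"
    using dimR_locus_component[OF F(1,3)] dimR_locus_component[OF _ KF] F(1) dim_annih_insert[of _ "fst ` F" \<alpha>]
    by fastforce
qed

lemma arr_subset: "arr C S A \<Longrightarrow> B \<subseteq> A \<Longrightarrow> arr C S B"
  unfolding arr_def by (auto intro: finite_subset)

lemma Lpos_layers:
  assumes "layer C S" and "finite A" and "\<And>K. K \<in> A \<Longrightarrow> layer C K"
  shows "finite (Lpos S A)" and "\<And>X. X \<in> Lpos S A \<Longrightarrow> layer C X"
proof -
  have *: "finite (components (S \<inter> \<Inter>B))" "X \<in> components (S \<inter> \<Inter>B) \<Longrightarrow> layer C X" if "B \<subseteq> A" for B X
    using components_Int_layers[OF assms(1), of B] that assms(2,3) finite_subset by blast+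
  show "finite (Lpos S A)" unfolding Lpos_def using assms(2) * by auto
  show "layer C X" if "X \<in> Lpos S A" for X using that * unfolding Lpos_def by blast
qed

lemma self_in_Lpos: "layer C S \<Longrightarrow> S \<in> Lpos S A"
  using components_eq_sing_iff[of S] layer_connected[of C S] layer_nonempty[of C S]
  by (auto simp: Lpos_def intro!: bexI[of _ "{}"])

text \<open>Layers have non-negative dimension, which bounds every rank; this supplies the premise
  of \<open>factor_exp_iff\<close>.\<close>

lemma rkA_le_ellA:
  fixes C :: "'g::finite set"
  assumes "layer C S" and "finite (Lpos S A)" and "\<And>X. X \<in> Lpos S A \<Longrightarrow> layer C X"
  shows "rkA C S A \<le> ellA C S"
  unfolding rkA_def
proof (subst Max_le_iff)
  show "\<forall>r\<in>rkL C S ` Lpos S A. r \<le> ellA C S"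
    using dimR_layer_dvd(2)[OF assms(3)]
    by (auto simp: rkL_def ellA_def intro!: nat_mono zdiv_mono1)
qed (use assms(2) self_in_Lpos[OF assms(1)] in auto)

lemma charpoly_restr: "charpoly C H (restr H A) = charpoly C H A"
  by (simp add: charpoly_def Lpos_restr)

lemma rkA_restr: "rkA C H (restr H A) = rkA C H A"
  by (simp add: rkA_def Lpos_restr)

lemma arr_layer: "arr C S A \<Longrightarrow> layer C S" and arr_finite: "arr C S A \<Longrightarrow> finite A"
  by (simp_all add: arr_def)

lemma arr_proper:
  fixes C :: "'g::finite set"
  assumes "arr C S A" "K \<in> A"
  shows "\<not> S \<subseteq> K"
  using dimR_layer_mono[OF arr_layer[OF assms(1)] arr_member(1)[OF assms]] arr_member(3)[OF assms]
  by (auto simp: card_gt_0_iff)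

section \<open>Deletion and restriction\<close>

text \<open>The Whitney sum for \<open>H\<close> runs over subsets of \<open>A - {H}\<close> and not
  of the restriction, where members may have merged or split; \<open>charpoly_restr\<close>
  identifies the two. A subset containing \<open>H\<close> has one element more, whence the minus
  sign.\<close>

lemma charpoly_deletion_restriction:
  fixes C :: "'g::finite set" and A :: "(complex^'g^'l) set set"
  assumes arr: "arr C S A" and H: "H \<in> A"
  shows "charpoly C S A = charpoly C S (A - {H}) - charpoly C H (restr H (A - {H}))"
proof -
  let ?A = "A - {H}"
  let ?w = "\<lambda>S B. (-1) ^ card B * (\<Sum>X\<in>components (S \<inter> \<Inter>B). monom (1::int) (nat (dimR C X)))"
  note mem = arr_member[OF arr]
  have fin: "finite A" "finite ?A" using arr_finite[OF arr] by auto
  have S: "layer C S" using arr by (rule arr_layer)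
  have 1: "charpoly C S B = (\<Sum>B\<in>Pow B. ?w S B)" if "B \<subseteq> A" for B
    using that mem(1) arr_proper[OF arr] finite_subset[OF that fin(1)]
    by (intro charpoly_Whitney layer_connected[OF S] layer_nonempty[OF S] Lpos_layers(1)[OF S]) auto
  have 2: "charpoly C H ?A = (\<Sum>B\<in>Pow ?A. ?w H B)"
  proof (intro charpoly_Whitney layer_connected[OF mem(1)[OF H]] layer_nonempty[OF mem(1)[OF H]] H fin
      Lpos_layers(1)[OF mem(1)[OF H]])
    \<comment> \<open>A member containing \<open>H\<close> would be a layer of the same dimension,
      hence equal to \<open>H\<close>.\<close>
    fix K assume K: "K \<in> ?A"
    show "\<not> H \<subseteq> K"
      using layer_eqI_dimR[OF mem(1)[OF H] mem(1), of K] mem(3)[of K] mem(3)[OF H] K by auto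
  qed (use mem(1) in auto)
  have A: "A = insert H ?A" using H by blast
  have "charpoly C S A = (\<Sum>B\<in>Pow (insert H ?A). ?w S B)" using 1[of A] A by simp
  also have "\<dots> = (\<Sum>B\<in>Pow ?A. ?w S B) + (\<Sum>B\<in>insert H ` Pow ?A. ?w S B)"
    unfolding Pow_insert by (rule sum.union_disjoint) (use fin in auto)
  also have "(\<Sum>B\<in>insert H ` Pow ?A. ?w S B) = (\<Sum>B\<in>Pow ?A. ?w S (insert H B))"
    by (rule sum.reindex_cong[of "insert H"]) (auto simp: inj_on_def)
  also have "\<dots> = (\<Sum>B\<in>Pow ?A. - ?w H B)"
  proof (rule sum.cong[OF refl])
    fix B assume B: "B \<in> Pow ?A"
    have "card (insert H B) = Suc (card B)"
      using B fin by (intro card_insert_disjoint) (auto intro: finite_subset)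
    moreover have "S \<inter> \<Inter>(insert H B) = H \<inter> \<Inter>B" using mem(2)[OF H] by auto
    ultimately show "?w S (insert H B) = - ?w H B" by simp
  qed
  also have "\<dots> = - charpoly C H ?A" using 2 by (simp add: sum_negf)
  finally show ?thesis using 1[of ?A] by (simp add: charpoly_restr)
qed

text \<open>Besides the layers of the deletion there are those inside \<open>H\<close>. As
  \<open>H\<close> has codimension g in \<open>S\<close>, their rank grows by 1 when measured from
  \<open>S\<close>.\<close>

lemma rkA_deletion_restriction:
  fixes C :: "'g::finite set" and A :: "(complex^'g^'l) set set"
  assumes arr: "arr C S A" and H: "H \<in> A"
  shows "rkA C S A = max (rkA C S (A - {H})) (rkA C H (restr H (A - {H})) + 1)"
proof -
  let ?A = "A - {H}"
  note mem = arr_member[OF arr]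
  have fin: "finite ?A" using arr_finite[OF arr] by auto
  have S: "layer C S" using arr by (rule arr_layer)
  have HL: "layer C H" using mem(1) H by blast
  have finL: "finite (Lpos S ?A)" "finite (Lpos H ?A)"
    using Lpos_layers(1)[OF S fin] Lpos_layers(1)[OF HL fin] mem(1) by auto
  have A: "A = insert H ?A" using H by blast
  have L: "Lpos S A = Lpos S ?A \<union> Lpos H ?A" using Lpos_insert[OF mem(2)[OF H], of ?A] A by simp
  have rk: "rkL C S X = rkL C H X + 1" if X: "X \<in> Lpos H ?A" for X
  proof -
    have "layer C X" using Lpos_layers(2)[OF HL fin _ X] mem(1) by auto
    moreover have "X \<subseteq> H" using X in_components_subset unfolding Lpos_def by blast
    ultimately have "dimR C H - dimR C X \<ge> 0" using dimR_layer_mono HL by fastforce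
    moreover have "dimR C S - dimR C X = (dimR C H - dimR C X) + int CARD('g)" using mem(3)[OF H] by simp
    ultimately show ?thesis
      unfolding rkL_def \<open>dimR C S - dimR C X = _\<close>
      by (simp add: div_add_self2 nat_add_distrib pos_imp_zdiv_nonneg_iff del: diff_ge_0_iff_ge)
  qed
  have ne: "Lpos S ?A \<noteq> {}" "Lpos H ?A \<noteq> {}" using self_in_Lpos S HL by blast+
  have "rkL C S ` Lpos S A = rkL C S ` Lpos S ?A \<union> (\<lambda>n. n + 1) ` rkL C H ` Lpos H ?A"
    unfolding L image_Un image_image using rk by (simp cong: image_cong_simp)
  then have "rkA C S A = max (rkA C S ?A) (Max ((\<lambda>n. n + 1) ` rkL C H ` Lpos H ?A))"
    unfolding rkA_def using finL ne by (simp add: Max_Un)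
  also have "Max ((\<lambda>n. n + 1) ` rkL C H ` Lpos H ?A) = rkA C H ?A + 1"
    unfolding rkA_def using finL ne by (intro mono_Max_commute[symmetric]) (auto simp: mono_def)
  finally show ?thesis by (simp add: rkA_restr)
qed

lemma ellA_deletion_restriction:
  fixes C :: "'g::finite set" and A :: "(complex^'g^'l) set set"
  assumes arr: "arr C S A" and H: "H \<in> A"
  shows "ellA C S = ellA C H + 1"
  using arr_member(3)[OF assms] dimR_layer_dvd(2)[OF arr_member(1)[OF assms]]
  unfolding ellA_def by (simp add: div_add_self2 nat_add_distrib pos_imp_zdiv_nonneg_iff)

lemma arr_rkA_le_ellA:
  fixes C :: "'g::finite set"
  assumes "arr C S A"
  shows "rkA C S A \<le> ellA C S"
  using rkA_le_ellA[OF arr_layer[OF assms]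
      Lpos_layers[OF arr_layer[OF assms] arr_finite[OF assms] arr_member(1)[OF assms]]] .

lemma restr_rkA_le_ellA:
  fixes C :: "'g::finite set"
  assumes "arr C S A" "H \<in> A"
  shows "rkA C H (restr H (A - {H})) \<le> ellA C H"
proof -
  have "layer C H" "finite (A - {H})" "\<And>K. K \<in> A - {H} \<Longrightarrow> layer C K"
    using arr_member(1)[OF assms(1)] assms arr_finite by auto
  from rkA_le_ellA[OF this(1) Lpos_layers[OF this]] show ?thesis by (simp add: rkA_restr)
qed

section \<open>Exponents of inductive arrangements\<close>

text \<open>Subtracting the polynomial of the restriction from its multiple by t^g - d leaves the
  multiple by t^g - (d + 1). The second claim is the side condition of
  \<open>inductive_arr.step\<close>.\<close>

lemma factor_exp_deletion_restriction:
  fixes C :: "'g::finite set" and A :: "(complex^'g^'l) set set"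
  assumes arr: "arr C S A" and H: "H \<in> A"
    and del: "factor_exp C S (A - {H}) (D + {#d#})"
    and res: "factor_exp C H (restr H (A - {H})) D"
  shows "factor_exp C S A (D + {#d + 1#})"
    and "charpoly C S (A - {H}) = (monom 1 CARD('g) - [:d:]) * charpoly C H (restr H (A - {H}))"
proof -
  let ?t = "monom 1 CARD('g) :: int poly"
  have d: "d \<ge> 0" "rkA C S (A - {H}) + count (D + {#d#}) 0 = ellA C S"
    "charpoly C S (A - {H}) = (\<Prod>d\<in>#D + {#d#}. ?t - [:d:])"
    using del unfolding factor_exp_iff[OF arr_rkA_le_ellA[OF arr_subset[OF arr Diff_subset]]] by auto
  have D: "\<forall>d\<in>#D. d \<ge> 0" "size D = ellA C H" "rkA C H (restr H (A - {H})) + count D 0 = ellA C H"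
    "charpoly C H (restr H (A - {H})) = (\<Prod>d\<in>#D. ?t - [:d:])"
    using res unfolding factor_exp_iff[OF restr_rkA_le_ellA[OF arr H]] by auto
  show eq: "charpoly C S (A - {H}) = (?t - [:d:]) * charpoly C H (restr H (A - {H}))"
    using d(3) D(4) by simp
  have t: "?t - [:d + 1:] = ?t - [:d:] - 1" by (simp add: one_pCons)
  have "charpoly C S A = (?t - [:d:]) * (\<Prod>d\<in>#D. ?t - [:d:]) - (\<Prod>d\<in>#D. ?t - [:d:])"
    using charpoly_deletion_restriction[OF arr H] unfolding eq D(4) .
  also have "\<dots> = (?t - [:d + 1:]) * (\<Prod>d\<in>#D. ?t - [:d:])"
    unfolding t left_diff_distrib mult_1_left ..
  also have "\<dots> = (\<Prod>d\<in>#D + {#d + 1#}. ?t - [:d:])" by simp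
  finally have "charpoly C S A = (\<Prod>d\<in>#D + {#d + 1#}. ?t - [:d:])" .
  \<comment> \<open>As \<open>d + 1\<close> is positive, only \<open>D\<close> contributes zeros.
    The rank of the restriction plus 1 is \<open>ellA C S - count D 0\<close>; the rank of the
    deletion equals this, or is one less when \<open>d = 0\<close>.\<close>
  moreover have "rkA C S A + count (D + {#d + 1#}) 0 = ellA C S"
    using rkA_deletion_restriction[OF arr H] d(1,2) D(3) ellA_deletion_restriction[OF arr H]
    by (auto split: if_splits)
  ultimately show "factor_exp C S A (D + {#d + 1#})"
    unfolding factor_exp_iff[OF arr_rkA_le_ellA[OF arr]]
    using d(1) D(1,2) ellA_deletion_restriction[OF arr H] by auto
qed

lemma factor_exp_empty:
  fixes C :: "'g::finite set" and S :: "(complex^'g^'l) set"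
  assumes S: "layer C S"
  shows "factor_exp C S {} (replicate_mset (ellA C S) 0)"
proof -
  have L: "Lpos S {} = {S}"
    using layer_connected[OF S] layer_nonempty[OF S] by (simp add: Lpos_def components_eq_sing_iff)
  have "mobius {S} (\<lambda>X Y. Y \<subseteq> X) S S = 1"
    by (rule mobius_superset_eqI[of "{S}" S "\<lambda>_. 1"]) (auto simp: Collect_conv_if)
  then have "charpoly C S {} = monom 1 (nat (dimR C S))" by (simp add: charpoly_def L)
  also have "nat (dimR C S) = CARD('g) * ellA C S"
    using dimR_layer_dvd[OF S] unfolding ellA_def
    by (metis dvd_mult_div_cancel nat_int nat_mult_distrib of_nat_0_le_iff)
  finally show ?thesis
    unfolding factor_exp_def by (intro exI[of _ "[]"]) (simp add: rkA_def rkL_def L)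
qed

text \<open>The polynomial determines its factors, so the description in \<open>expA\<close> has at
  most one candidate.\<close>

lemma factor_exp_unique:
  fixes C :: "'g::finite set"
  assumes "rkA C S A \<le> ellA C S" "factor_exp C S A M" "factor_exp C S A N"
  shows "M = N"
  using assms unfolding factor_exp_iff[OF assms(1)]
  by (intro prod_mset_monom_factors_inject[of "CARD('g)"]) auto

lemma inductive_arr_rkA_le_ellA:
  fixes C :: "'g::finite set"
  assumes "inductive_arr C S A"
  shows "rkA C S A \<le> ellA C S"
  using assms
proof cases
  case empty
  then have "arr C S A" by (simp add: arr_def)
  then show ?thesis by (rule arr_rkA_le_ellA)
qed (rule arr_rkA_le_ellA)

text \<open>The rule \<open>step\<close> supplies merely an integer \<open>d\<close> with a
  polynomial identity. Comparing factors with those of the deletion gives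
  \<open>M = D + {#d#}\<close>, so \<open>d\<close> is itself an exponent and in particular
  non-negative.\<close>

lemma inductive_arr_factorable:
  fixes C :: "'g::finite set"
  assumes "inductive_arr C S A"
  shows "factorable C S A"
  using assms
proof induction
  case (empty S)
  then show ?case using factor_exp_empty unfolding factorable_def by blast
next
  case (step S A H d)
  obtain M where M: "factor_exp C S (A - {H}) M" using step.IH unfolding factorable_def by blast
  obtain D where D: "factor_exp C H (restr H (A - {H})) D" using step.IH unfolding factorable_def by blast
  have "(\<Prod>d\<in>#M. monom 1 CARD('g) - [:d:]) = (\<Prod>d\<in>#D + {#d#}. monom 1 CARD('g) - [:d:])"
    using step.hyps M D
    unfolding factor_exp_iff[OF inductive_arr_rkA_le_ellA[OF step.hyps(3)]]
      factor_exp_iff[OF inductive_arr_rkA_le_ellA[OF step.hyps(4)]] by simp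
  then have "M = D + {#d#}" by (intro prod_mset_monom_factors_inject[of "CARD('g)"]) auto
  then show ?case
    using factor_exp_deletion_restriction(1)[OF step.hyps(1,2) _ D] M unfolding factorable_def by blast
qed

lemma factor_exp_expA:
  fixes C :: "'g::finite set"
  assumes "inductive_arr C S A"
  shows "factor_exp C S A M \<longleftrightarrow> expA C S A = M"
proof -
  obtain N where N: "factor_exp C S A N"
    using inductive_arr_factorable[OF assms] unfolding factorable_def by blast
  have u: "M = N" if "factor_exp C S A M" for M
    using factor_exp_unique[OF inductive_arr_rkA_le_ellA[OF assms] that N] .
  have "expA C S A = N" unfolding expA_def using N u by (rule the_equality)
  then show ?thesis using N u by blast
qed

theorem theorem5p14:
  fixes C :: "'g::finite set"
    and A :: "(complex^'g^'l) set set"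
    and H :: "(complex^'g^'l) set"
    and D :: "int multiset"
    and dl :: int
  assumes "arr C (Tor C) A"
    and "A \<noteq> {}"
    and "H \<in> A"
    and "inductive_arr C H (restr H (A - {H}))"
    and "expA C H (restr H (A - {H})) = D"
    and "inductive_arr C (Tor C) (A - {H})"
    and "expA C (Tor C) (A - {H}) = D + {#dl#}"
  shows "inductive_arr C (Tor C) A \<and> expA C (Tor C) A = D + {#dl + 1#}"
proof -
  \<comment> \<open>Inductivity of deletion and restriction turns the equations for
    \<open>expA\<close> into actual factorisations.\<close>
  have "factor_exp C (Tor C) (A - {H}) (D + {#dl#})" "factor_exp C H (restr H (A - {H})) D"
    using assms by (simp_all add: factor_exp_expA)
  note step = factor_exp_deletion_restriction[OF assms(1,3) this]
  have "inductive_arr C (Tor C) A"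
    by (rule inductive_arr.step[OF assms(1,3,6,4) step(2)])
  then show ?thesis using step(1) factor_exp_expA by blast
qed

end
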